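(* Let $(M,\lambda_{(i)}(x,y))$ be a GAP-space equipped with a non-linear connection $N^\alpha_\mu$, and let $|$, $||$ be the $h$- and $v$-covariant derivatives of its canonical $d$-connection. Let $\widetilde H$, $\widetilde V$ be the $hW$- and $vW$-tensors of the dual $d$-connection, and $\widehat H$, $\mathring H$ the $hW$-tensors of the symmetric and Riemannian $d$-connections. Let $\widetilde H_{\mu\sigma}:=\widetilde H^\alpha_{\mu\alpha\sigma}$, $\widehat H_{\mu\sigma}:=\widehat H^\alpha_{\mu\alpha\sigma}$, $\mathring H_{\mu\sigma}:=\mathring H^\alpha_{\mu\alpha\sigma}$ and $\widetilde V_{\mu\sigma}:=\widetilde V^\alpha_{\mu\alpha\sigma}$. Then (a) $\widetilde H_{\mu\sigma}=\beta_{\sigma|\mu}+\Lambda^\epsilon_{\alpha\sigma}\Lambda^\alpha_{\mu\epsilon}+\mathfrak S_{\alpha,\mu,\sigma}L^\alpha_{\alpha\mu\sigma}$; (b) $\widetilde V_{\mu\sigma}=B_{\sigma||\mu}+T^\epsilon_{\alpha\sigma}T^\alpha_{\mu\epsilon}$; (c) $\widehat H_{\mu\sigma}=\tfrac12\widetilde H_{\mu\sigma}+\tfrac14(\beta_\epsilon\Lambda^\epsilon_{\sigma\mu}+\Lambda^\epsilon_{\sigma\alpha}\Lambda^\alpha_{\mu\epsilon})$; (d) $\mathring H_{\mu\sigma}=\beta_{\mu|\sigma}-\gamma^\alpha_{\mu\sigma|\alpha}+\beta_\epsilon\gamma^\epsilon_{\mu\sigma}-\gamma^\epsilon_{\sigma\alpha}\gamma^\alpha_{\mu\epsilon}$,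 where $\mathfrak S_{\alpha,\mu,\sigma}L^\alpha_{\alpha\mu\sigma}:=L^\alpha_{\alpha\mu\sigma}+L^\alpha_{\mu\sigma\alpha}+L^\alpha_{\sigma\alpha\mu}$ (cyclic sum over the lower indices, summed over $\alpha$).
   Context: $M$ is a $C^\infty$ manifold of dimension $n$, $\pi:TM\to M$ its tangent bundle with induced local coordinates $(x^\mu,y^\mu)$; $\partial_\mu=\partial/\partial x^\mu$, $\dot\partial_\mu=\partial/\partial y^\mu$. All objects are smooth in $(x,y)$. Summation convention on repeated Greek and repeated Latin indices. A non-linear connection is a system of functions $N^\alpha_\beta(x,y)$ on induced charts of $TM$ transforming by $N^{\alpha'}_{\beta'}=p^{\alpha'}_{\alpha}p^{\beta}_{\beta'}N^\alpha_\beta+p^{\alpha'}_{\epsilon}p^{\epsilon}_{\beta'\sigma'}y^{\sigma'}$, where $p^{\alpha'}_{\alpha}=\partial x^{\alpha'}/\partial x^{\alpha}$, $p^{\epsilon}_{\beta'\sigma'}=\partial^2x^\epsilon/\partial x^{\beta'}\partial x^{\sigma'}$; set $\delta_\mu=\partial_\mu-N^\alpha_\mu\dot\partial_\alpha$ and $R^\alpha_{\sigma\mu}:=\delta_\mu N^\alpha_\sigma-\delta_\sigma N^\alpha_\mu$ (curvature of $N$). A GAP-space is a manifold $M$ together with $n$ global linearly independent sections $\lambda_{(i)}=(\lambda_{(i)}^\alpha(x,y))$ of the pullback bundle $\pi^{-1}(TM)$; $(\lambda_{(i)\alpha})$ is the inverse matrix ($\lambda_{(i)}^\alpha\lambda_{(i)\beta}=\delta^\alpha_\beta$,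 $\lambda_{(i)}^\alpha\lambda_{(j)\alpha}=\delta_{ij}$), and $g_{\mu\nu}=\lambda_{(i)\mu}\lambda_{(i)\nu}$ its metric, with inverse $g^{\mu\nu}$. $d$-connections (all with the same $N$): - canonical $D=(N,\Gamma,C)$: $\Gamma^\alpha_{\mu\nu}=\lambda_{(i)}^\alpha\delta_\nu\lambda_{(i)\mu}$, $C^\alpha_{\mu\nu}=\lambda_{(i)}^\alpha\dot\partial_\nu\lambda_{(i)\mu}$; - Riemannian $\mathring D=(N,\mathring\Gamma,\mathring C)$: $\mathring\Gamma^\alpha_{\mu\nu}=\tfrac12g^{\alpha\epsilon}(\delta_\mu g_{\nu\epsilon}+\delta_\nu g_{\mu\epsilon}-\delta_\epsilon g_{\mu\nu})$, $\mathring C^\alpha_{\mu\nu}=\tfrac12g^{\alpha\epsilon}(\dot\partial_\mu g_{\nu\epsilon}+\dot\partial_\nu g_{\mu\epsilon}-\dot\partial_\epsilon g_{\mu\nu})$; - dual $\widetilde D=(N,\widetilde\Gamma,\widetilde C)$: $\widetilde\Gamma^\alpha_{\mu\nu}=\Gamma^\alpha_{\nu\mu}$, $\widetilde C^\alpha_{\mu\nu}=C^\alpha_{\nu\mu}$; - symmetric $\widehat D=(N,\widehat\Gamma,\widehat C)$: $\widehat\Gamma^\alpha_{\mu\nu}=\tfrac12(\Gamma^\alpha_{\mu\nu}+\Gamma^\alpha_{\nu\mu})$, $\widehat C^\alpha_{\mu\nu}=\tfrac12(C^\alpha_{\mu\nu}+C^\alpha_{\nu\mu})$. For a $d$-connection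 $(N,\Gamma,C)$ the $h$- and $v$-covariant derivatives are $A^\alpha_{\mu|\nu}=\delta_\nu A^\alpha_\mu+A^\epsilon_\mu\Gamma^\alpha_{\epsilon\nu}-A^\alpha_\epsilon\Gamma^\epsilon_{\mu\nu}$, $A^\alpha_{\mu||\nu}=\dot\partial_\nu A^\alpha_\mu+A^\epsilon_\mu C^\alpha_{\epsilon\nu}-A^\alpha_\epsilon C^\epsilon_{\mu\nu}$ (similarly for other tensor types); $X_{\mu|\nu\sigma}:=(X_{\mu|\nu})_{|\sigma}$, $X_{\mu||\nu\sigma}:=(X_{\mu||\nu})_{||\sigma}$. Its $hW$-tensor $H^\alpha_{\mu\nu\sigma}$ and $vW$-tensor $V^\alpha_{\mu\nu\sigma}$ are defined by requiring, for every $i$, $$\lambda_{(i)\mu|\nu\sigma}-\lambda_{(i)\mu|\sigma\nu}=\lambda_{(i)\epsilon}H^\epsilon_{\mu\nu\sigma},\qquad \lambda_{(i)\mu||\nu\sigma}-\lambda_{(i)\mu||\sigma\nu}=\lambda_{(i)\epsilon}V^\epsilon_{\mu\nu\sigma},$$ with covariant derivatives taken with respect to that $d$-connection. The $W$-tensors of $\widetilde D,\widehat D,\mathring D$ carry the corresponding decoration. Tensors of the canonical $d$-connection: $\Lambda^\alpha_{\mu\nu}=\Gamma^\alpha_{\mu\nu}-\Gamma^\alpha_{\nu\mu}$, $T^\alpha_{\mu\nu}=C^\alpha_{\mu\nu}-C^\alpha_{\nu\mu}$, $\gamma^\alpha_{\mu\nu}=\Gamma^\alpha_{\mu\nu}-\mathring\Gamma^\alpha_{\mu\nu}$,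 $\beta_\mu=\Lambda^\epsilon_{\mu\epsilon}=\gamma^\epsilon_{\mu\epsilon}$, $B_\mu=T^\epsilon_{\mu\epsilon}$, $L^\alpha_{\nu\mu\sigma}=C^\alpha_{\nu\epsilon}R^\epsilon_{\mu\sigma}$. *)

theory Defs
  imports "HOL-Analysis.Analysis"
begin

section \<open>Smooth manifolds and induced charts on the tangent bundle\<close>

fun C_k_on :: "nat \<Rightarrow> ('a::real_normed_vector \<Rightarrow> 'b::real_normed_vector) \<Rightarrow> 'a set \<Rightarrow> bool" where
  "C_k_on 0 f S \<longleftrightarrow> continuous_on S f"
| "C_k_on (Suc k) f S \<longleftrightarrow>
     (\<forall>x\<in>S. f differentiable (at x)) \<and>
     (\<forall>v. C_k_on k (\<lambda>x. frechet_derivative f (at x) v) S)"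

text \<open>Only meant for open \<open>S\<close>.\<close>

definition smooth_on :: "('a::real_normed_vector \<Rightarrow> 'b::real_normed_vector) \<Rightarrow> 'a set \<Rightarrow> bool" where
  "smooth_on f S \<longleftrightarrow> (\<forall>k. C_k_on k f S)"

type_synonym ('m, 'n) chart = "'m set \<times> ('m \<Rightarrow> real^'n)"

definition transition :: "('m, 'n::finite) chart \<Rightarrow> ('m, 'n) chart \<Rightarrow> real^'n \<Rightarrow> real^'n" where
  "transition c c' x = snd c' (inv_into (fst c) (snd c) x)"

definition overlap :: "('m, 'n::finite) chart \<Rightarrow> ('m, 'n) chart \<Rightarrow> (real^'n) set" where
  "overlap c c' = snd c ` (fst c \<inter> fst c')"

definition smooth_atlas ::
  "('m::{t2_space, second_countable_topology}, 'n::finite) chart set \<Rightarrow> bool" where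
  "smooth_atlas \<A> \<longleftrightarrow>
     (\<forall>(U, \<phi>)\<in>\<A>. open U \<and> open (\<phi> ` U) \<and> homeomorphism U (\<phi> ` U) \<phi> (inv_into U \<phi>)) \<and>
     (\<Union>(U, \<phi>)\<in>\<A>. U) = UNIV \<and>
     (\<forall>c\<in>\<A>. \<forall>c'\<in>\<A>. smooth_on (transition c c') (overlap c c'))"

text \<open>\<open>jac c c' x \<alpha>' \<alpha>\<close> is \<open>\<partial>x\<^sup>\<alpha>\<^sup>'/\<partial>x\<^sup>\<alpha>\<close> at the point with \<open>c\<close>-coordinates \<open>x\<close>, for unprimed
  coordinates \<open>c\<close> and primed coordinates \<open>c'\<close>;
  \<open>hess c c' x \<alpha>' \<alpha> \<beta>\<close> is \<open>\<partial>\<^sup>2x\<^sup>\<alpha>\<^sup>'/\<partial>x\<^sup>\<alpha>\<partial>x\<^sup>\<beta>\<close>.\<close>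

definition jac :: "('m, 'n::finite) chart \<Rightarrow> ('m, 'n) chart \<Rightarrow> real^'n \<Rightarrow> 'n \<Rightarrow> 'n \<Rightarrow> real" where
  "jac c c' x \<alpha>' \<alpha> = frechet_derivative (\<lambda>x. transition c c' x $ \<alpha>') (at x) (axis \<alpha> 1)"

definition hess :: "('m, 'n::finite) chart \<Rightarrow> ('m, 'n) chart \<Rightarrow> real^'n \<Rightarrow> 'n \<Rightarrow> 'n \<Rightarrow> 'n \<Rightarrow> real" where
  "hess c c' x \<alpha>' \<alpha> \<beta> = frechet_derivative (\<lambda>x. jac c c' x \<alpha>' \<alpha>) (at x) (axis \<beta> 1)"

text \<open>The coordinate representation \<open>(x, y)\<close> of the induced chart of \<open>TM\<close>: its range
  and the corresponding change of coordinates.\<close>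

definition induced_range :: "('m, 'n::finite) chart \<Rightarrow> ((real^'n) \<times> (real^'n)) set" where
  "induced_range c = (snd c ` fst c) \<times> UNIV"

definition induced_transition ::
  "('m, 'n::finite) chart \<Rightarrow> ('m, 'n) chart \<Rightarrow> (real^'n) \<times> (real^'n) \<Rightarrow> (real^'n) \<times> (real^'n)" where
  "induced_transition c c' z =
     (transition c c' (fst z), \<chi> \<alpha>'. \<Sum>\<alpha>\<in>UNIV. jac c c' (fst z) \<alpha>' \<alpha> * snd z $ \<alpha>)"

section \<open>Non-linear connections and GAP-spaces\<close>

text \<open>A geometric object on \<open>TM\<close> is given by its component functions of \<open>(x, y)\<close> in every
  induced chart. Index conventions: \<open>N \<alpha> \<beta>\<close> stands for \<open>N\<^sup>\<alpha>\<^sub>\<beta>\<close>, \<open>lam i \<alpha>\<close> for \<open>\<lambda>\<^sub>(\<^sub>i\<^sub>)\<^sup>\<alpha>\<close>, and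
  \<open>G \<alpha> \<mu> \<nu>\<close> for \<open>G\<^sup>\<alpha>\<^sub>\<mu>\<^sub>\<nu>\<close>.\<close>

type_synonym 'n tmfun = "(real^'n) \<times> (real^'n) \<Rightarrow> real"

definition nonlinear_connection ::
  "('m::{t2_space, second_countable_topology}, 'n::finite) chart set \<Rightarrow>
   (('m, 'n) chart \<Rightarrow> 'n \<Rightarrow> 'n \<Rightarrow> 'n tmfun) \<Rightarrow> bool" where
  "nonlinear_connection \<A> N \<longleftrightarrow>
     (\<forall>c\<in>\<A>. \<forall>\<alpha> \<beta>. smooth_on (N c \<alpha> \<beta>) (induced_range c)) \<and>
     (\<forall>c\<in>\<A>. \<forall>c'\<in>\<A>. \<forall>x\<in>overlap c c'. \<forall>y \<alpha>' \<beta>'.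
        let x' = fst (induced_transition c c' (x, y)); y' = snd (induced_transition c c' (x, y)) in
        N c' \<alpha>' \<beta>' (x', y') =
          (\<Sum>\<alpha>\<in>UNIV. \<Sum>\<beta>\<in>UNIV. jac c c' x \<alpha>' \<alpha> * jac c' c x' \<beta> \<beta>' * N c \<alpha> \<beta> (x, y)) +
          (\<Sum>\<epsilon>\<in>UNIV. \<Sum>\<sigma>'\<in>UNIV. jac c c' x \<alpha>' \<epsilon> * hess c' c x' \<epsilon> \<beta>' \<sigma>' * y' $ \<sigma>'))"

text \<open>\<open>n\<close> global smooth sections of the pullback bundle, linearly independent at every point of
  \<open>TM\<close>; the frame index \<open>i\<close> also ranges over \<open>'n\<close>.\<close>

definition gap_space ::
  "('m::{t2_space, second_countable_topology}, 'n::finite) chart set \<Rightarrow>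
   (('m, 'n) chart \<Rightarrow> 'n \<Rightarrow> 'n \<Rightarrow> 'n tmfun) \<Rightarrow> bool" where
  "gap_space \<A> lam \<longleftrightarrow>
     smooth_atlas \<A> \<and>
     (\<forall>c\<in>\<A>. \<forall>i \<alpha>. smooth_on (lam c i \<alpha>) (induced_range c)) \<and>
     (\<forall>c\<in>\<A>. \<forall>c'\<in>\<A>. \<forall>x\<in>overlap c c'. \<forall>y i \<alpha>'.
        lam c' i \<alpha>' (induced_transition c c' (x, y)) =
          (\<Sum>\<alpha>\<in>UNIV. jac c c' x \<alpha>' \<alpha> * lam c i \<alpha> (x, y))) \<and>
     (\<forall>c\<in>\<A>. \<forall>z\<in>induced_range c. \<forall>a :: 'n \<Rightarrow> real.
        (\<Sum>i\<in>UNIV. a i *\<^sub>R (\<chi> \<alpha>. lam c i \<alpha> z)) = 0 \<longrightarrow> (\<forall>i. a i = 0))"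

section \<open>Calculus in an induced chart\<close>

definition pdx :: "'n::finite \<Rightarrow> 'n tmfun \<Rightarrow> 'n tmfun" where
  "pdx \<mu> f z = frechet_derivative f (at z) (axis \<mu> 1, 0)"

definition pdy :: "'n::finite \<Rightarrow> 'n tmfun \<Rightarrow> 'n tmfun" where
  "pdy \<mu> f z = frechet_derivative f (at z) (0, axis \<mu> 1)"

definition delta :: "('n \<Rightarrow> 'n \<Rightarrow> 'n tmfun) \<Rightarrow> 'n::finite \<Rightarrow> 'n tmfun \<Rightarrow> 'n tmfun" where
  "delta N \<mu> f z = pdx \<mu> f z - (\<Sum>\<alpha>\<in>UNIV. N \<alpha> \<mu> z * pdy \<alpha> f z)"

definition N_curv :: "('n \<Rightarrow> 'n \<Rightarrow> 'n tmfun) \<Rightarrow> 'n::finite \<Rightarrow> 'n \<Rightarrow> 'n \<Rightarrow> 'n tmfun" where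
  "N_curv N \<alpha> \<sigma> \<mu> z = delta N \<mu> (N \<alpha> \<sigma>) z - delta N \<sigma> (N \<alpha> \<mu>) z"

text \<open>\<open>coframe lam i \<mu>\<close> is \<open>\<lambda>\<^sub>(\<^sub>i\<^sub>)\<^sub>\<mu>\<close>; see \<open>coframe_dual\<close> below for the position of the indices.\<close>

definition coframe :: "('n \<Rightarrow> 'n \<Rightarrow> 'n tmfun) \<Rightarrow> 'n::finite \<Rightarrow> 'n \<Rightarrow> 'n tmfun" where
  "coframe lam i \<mu> z = matrix_inv (\<chi> j \<alpha>. lam j \<alpha> z) $ \<mu> $ i"

definition metric :: "('n \<Rightarrow> 'n \<Rightarrow> 'n tmfun) \<Rightarrow> 'n::finite \<Rightarrow> 'n \<Rightarrow> 'n tmfun" where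
  "metric lam \<mu> \<nu> z = (\<Sum>i\<in>UNIV. coframe lam i \<mu> z * coframe lam i \<nu> z)"

definition inv_metric :: "('n \<Rightarrow> 'n \<Rightarrow> 'n tmfun) \<Rightarrow> 'n::finite \<Rightarrow> 'n \<Rightarrow> 'n tmfun" where
  "inv_metric lam \<mu> \<nu> z = matrix_inv (\<chi> \<alpha> \<beta>. metric lam \<alpha> \<beta> z) $ \<mu> $ \<nu>"

section \<open>The d-connections\<close>

record 'n dconn =
  nlc :: "'n \<Rightarrow> 'n \<Rightarrow> 'n tmfun"
  hcoef :: "'n \<Rightarrow> 'n \<Rightarrow> 'n \<Rightarrow> 'n tmfun"
  vcoef :: "'n \<Rightarrow> 'n \<Rightarrow> 'n \<Rightarrow> 'n tmfun"

definition canonical_dconn ::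
  "('n \<Rightarrow> 'n \<Rightarrow> 'n tmfun) \<Rightarrow> ('n \<Rightarrow> 'n \<Rightarrow> 'n tmfun) \<Rightarrow> 'n::finite dconn" where
  "canonical_dconn N lam = \<lparr> nlc = N,
     hcoef = (\<lambda>\<alpha> \<mu> \<nu> z. \<Sum>i\<in>UNIV. lam i \<alpha> z * delta N \<nu> (coframe lam i \<mu>) z),
     vcoef = (\<lambda>\<alpha> \<mu> \<nu> z. \<Sum>i\<in>UNIV. lam i \<alpha> z * pdy \<nu> (coframe lam i \<mu>) z) \<rparr>"

definition riemannian_dconn ::
  "('n \<Rightarrow> 'n \<Rightarrow> 'n tmfun) \<Rightarrow> ('n \<Rightarrow> 'n \<Rightarrow> 'n tmfun) \<Rightarrow> 'n::finite dconn" where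
  "riemannian_dconn N lam = \<lparr> nlc = N,
     hcoef = (\<lambda>\<alpha> \<mu> \<nu> z. 1/2 * (\<Sum>\<epsilon>\<in>UNIV. inv_metric lam \<alpha> \<epsilon> z *
       (delta N \<mu> (metric lam \<nu> \<epsilon>) z + delta N \<nu> (metric lam \<mu> \<epsilon>) z - delta N \<epsilon> (metric lam \<mu> \<nu>) z))),
     vcoef = (\<lambda>\<alpha> \<mu> \<nu> z. 1/2 * (\<Sum>\<epsilon>\<in>UNIV. inv_metric lam \<alpha> \<epsilon> z *
       (pdy \<mu> (metric lam \<nu> \<epsilon>) z + pdy \<nu> (metric lam \<mu> \<epsilon>) z - pdy \<epsilon> (metric lam \<mu> \<nu>) z))) \<rparr>"

definition dual_dconn :: "'n dconn \<Rightarrow> 'n::finite dconn" where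
  "dual_dconn D = \<lparr> nlc = nlc D,
     hcoef = (\<lambda>\<alpha> \<mu> \<nu>. hcoef D \<alpha> \<nu> \<mu>),
     vcoef = (\<lambda>\<alpha> \<mu> \<nu>. vcoef D \<alpha> \<nu> \<mu>) \<rparr>"

definition symmetric_dconn :: "'n dconn \<Rightarrow> 'n::finite dconn" where
  "symmetric_dconn D = \<lparr> nlc = nlc D,
     hcoef = (\<lambda>\<alpha> \<mu> \<nu> z. 1/2 * (hcoef D \<alpha> \<mu> \<nu> z + hcoef D \<alpha> \<nu> \<mu> z)),
     vcoef = (\<lambda>\<alpha> \<mu> \<nu> z. 1/2 * (vcoef D \<alpha> \<mu> \<nu> z + vcoef D \<alpha> \<nu> \<mu> z)) \<rparr>"

text \<open>Covariant derivatives of tensors of type (0,1), (0,2) and (1,2), for a family of derivations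
  \<open>d\<close> and coefficients \<open>G\<close>: \<open>d = delta N\<close>, \<open>G = \<Gamma>\<close> gives the h- and \<open>d = pdy\<close>, \<open>G = C\<close> the
  v-covariant derivative. The index of differentiation comes last.\<close>

definition cov01 ::
  "('n \<Rightarrow> 'n tmfun \<Rightarrow> 'n tmfun) \<Rightarrow> ('n \<Rightarrow> 'n \<Rightarrow> 'n \<Rightarrow> 'n tmfun) \<Rightarrow>
   ('n \<Rightarrow> 'n tmfun) \<Rightarrow> 'n::finite \<Rightarrow> 'n \<Rightarrow> 'n tmfun" where
  "cov01 d G X \<mu> \<nu> z = d \<nu> (X \<mu>) z - (\<Sum>\<epsilon>\<in>UNIV. X \<epsilon> z * G \<epsilon> \<mu> \<nu> z)"

definition cov02 ::
  "('n \<Rightarrow> 'n tmfun \<Rightarrow> 'n tmfun) \<Rightarrow> ('n \<Rightarrow> 'n \<Rightarrow> 'n \<Rightarrow> 'n tmfun) \<Rightarrow>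
   ('n \<Rightarrow> 'n \<Rightarrow> 'n tmfun) \<Rightarrow> 'n::finite \<Rightarrow> 'n \<Rightarrow> 'n \<Rightarrow> 'n tmfun" where
  "cov02 d G A \<mu> \<nu> \<sigma> z = d \<sigma> (A \<mu> \<nu>) z
     - (\<Sum>\<epsilon>\<in>UNIV. A \<epsilon> \<nu> z * G \<epsilon> \<mu> \<sigma> z) - (\<Sum>\<epsilon>\<in>UNIV. A \<mu> \<epsilon> z * G \<epsilon> \<nu> \<sigma> z)"

definition cov12 ::
  "('n \<Rightarrow> 'n tmfun \<Rightarrow> 'n tmfun) \<Rightarrow> ('n \<Rightarrow> 'n \<Rightarrow> 'n \<Rightarrow> 'n tmfun) \<Rightarrow>
   ('n \<Rightarrow> 'n \<Rightarrow> 'n \<Rightarrow> 'n tmfun) \<Rightarrow> 'n::finite \<Rightarrow> 'n \<Rightarrow> 'n \<Rightarrow> 'n \<Rightarrow> 'n tmfun" where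
  "cov12 d G A \<alpha> \<mu> \<nu> \<sigma> z = d \<sigma> (A \<alpha> \<mu> \<nu>) z + (\<Sum>\<epsilon>\<in>UNIV. A \<epsilon> \<mu> \<nu> z * G \<alpha> \<epsilon> \<sigma> z)
     - (\<Sum>\<epsilon>\<in>UNIV. A \<alpha> \<epsilon> \<nu> z * G \<epsilon> \<mu> \<sigma> z) - (\<Sum>\<epsilon>\<in>UNIV. A \<alpha> \<mu> \<epsilon> z * G \<epsilon> \<nu> \<sigma> z)"

definition hcov01 :: "'n dconn \<Rightarrow> ('n \<Rightarrow> 'n tmfun) \<Rightarrow> 'n::finite \<Rightarrow> 'n \<Rightarrow> 'n tmfun" where
  "hcov01 D = cov01 (delta (nlc D)) (hcoef D)"

definition vcov01 :: "'n dconn \<Rightarrow> ('n \<Rightarrow> 'n tmfun) \<Rightarrow> 'n::finite \<Rightarrow> 'n \<Rightarrow> 'n tmfun" where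
  "vcov01 D = cov01 pdy (vcoef D)"

definition hcov02 ::
  "'n dconn \<Rightarrow> ('n \<Rightarrow> 'n \<Rightarrow> 'n tmfun) \<Rightarrow> 'n::finite \<Rightarrow> 'n \<Rightarrow> 'n \<Rightarrow> 'n tmfun" where
  "hcov02 D = cov02 (delta (nlc D)) (hcoef D)"

definition vcov02 ::
  "'n dconn \<Rightarrow> ('n \<Rightarrow> 'n \<Rightarrow> 'n tmfun) \<Rightarrow> 'n::finite \<Rightarrow> 'n \<Rightarrow> 'n \<Rightarrow> 'n tmfun" where
  "vcov02 D = cov02 pdy (vcoef D)"

definition hcov12 ::
  "'n dconn \<Rightarrow> ('n \<Rightarrow> 'n \<Rightarrow> 'n \<Rightarrow> 'n tmfun) \<Rightarrow> 'n::finite \<Rightarrow> 'n \<Rightarrow> 'n \<Rightarrow> 'n \<Rightarrow> 'n tmfun" where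
  "hcov12 D = cov12 (delta (nlc D)) (hcoef D)"

section \<open>W-tensors\<close>

text \<open>Existence and uniqueness of the described tensors: \<open>hW_tensor_eqI\<close>, \<open>hW_tensor_eq\<close> and the
  vertical counterparts below.\<close>

definition hW_tensor ::
  "'n dconn \<Rightarrow> ('n \<Rightarrow> 'n \<Rightarrow> 'n tmfun) \<Rightarrow> 'n::finite \<Rightarrow> 'n \<Rightarrow> 'n \<Rightarrow> 'n \<Rightarrow> 'n tmfun" where
  "hW_tensor D lam \<alpha> \<mu> \<nu> \<sigma> z =
     (THE H. \<forall>i \<mu> \<nu> \<sigma>.
        hcov02 D (hcov01 D (coframe lam i)) \<mu> \<nu> \<sigma> z - hcov02 D (hcov01 D (coframe lam i)) \<mu> \<sigma> \<nu> z =
        (\<Sum>\<epsilon>\<in>UNIV. coframe lam i \<epsilon> z * H \<epsilon> \<mu> \<nu> \<sigma>)) \<alpha> \<mu> \<nu> \<sigma>"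

definition vW_tensor ::
  "'n dconn \<Rightarrow> ('n \<Rightarrow> 'n \<Rightarrow> 'n tmfun) \<Rightarrow> 'n::finite \<Rightarrow> 'n \<Rightarrow> 'n \<Rightarrow> 'n \<Rightarrow> 'n tmfun" where
  "vW_tensor D lam \<alpha> \<mu> \<nu> \<sigma> z =
     (THE V. \<forall>i \<mu> \<nu> \<sigma>.
        vcov02 D (vcov01 D (coframe lam i)) \<mu> \<nu> \<sigma> z - vcov02 D (vcov01 D (coframe lam i)) \<mu> \<sigma> \<nu> z =
        (\<Sum>\<epsilon>\<in>UNIV. coframe lam i \<epsilon> z * V \<epsilon> \<mu> \<nu> \<sigma>)) \<alpha> \<mu> \<nu> \<sigma>"

definition contr :: "('n \<Rightarrow> 'n \<Rightarrow> 'n \<Rightarrow> 'n \<Rightarrow> 'n tmfun) \<Rightarrow> 'n::finite \<Rightarrow> 'n \<Rightarrow> 'n tmfun" where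
  "contr W \<mu> \<sigma> z = (\<Sum>\<alpha>\<in>UNIV. W \<alpha> \<mu> \<alpha> \<sigma> z)"

section \<open>Tensors of the canonical d-connection\<close>

definition h_torsion :: "'n dconn \<Rightarrow> 'n::finite \<Rightarrow> 'n \<Rightarrow> 'n \<Rightarrow> 'n tmfun" where
  "h_torsion D \<alpha> \<mu> \<nu> z = hcoef D \<alpha> \<mu> \<nu> z - hcoef D \<alpha> \<nu> \<mu> z"

definition v_torsion :: "'n dconn \<Rightarrow> 'n::finite \<Rightarrow> 'n \<Rightarrow> 'n \<Rightarrow> 'n tmfun" where
  "v_torsion D \<alpha> \<mu> \<nu> z = vcoef D \<alpha> \<mu> \<nu> z - vcoef D \<alpha> \<nu> \<mu> z"

definition h_contortion ::
  "('n \<Rightarrow> 'n \<Rightarrow> 'n tmfun) \<Rightarrow> ('n \<Rightarrow> 'n \<Rightarrow> 'n tmfun) \<Rightarrow> 'n::finite \<Rightarrow> 'n \<Rightarrow> 'n \<Rightarrow> 'n tmfun" where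
  "h_contortion N lam \<alpha> \<mu> \<nu> z =
     hcoef (canonical_dconn N lam) \<alpha> \<mu> \<nu> z - hcoef (riemannian_dconn N lam) \<alpha> \<mu> \<nu> z"

definition h_basic :: "'n dconn \<Rightarrow> 'n::finite \<Rightarrow> 'n tmfun" where
  "h_basic D \<mu> z = (\<Sum>\<epsilon>\<in>UNIV. h_torsion D \<epsilon> \<mu> \<epsilon> z)"

definition v_basic :: "'n dconn \<Rightarrow> 'n::finite \<Rightarrow> 'n tmfun" where
  "v_basic D \<mu> z = (\<Sum>\<epsilon>\<in>UNIV. v_torsion D \<epsilon> \<mu> \<epsilon> z)"

text \<open>\<open>L_tensor D \<alpha> \<nu> \<mu> \<sigma>\<close> is \<open>L\<^sup>\<alpha>\<^sub>\<nu>\<^sub>\<mu>\<^sub>\<sigma> = C\<^sup>\<alpha>\<^sub>\<nu>\<^sub>\<epsilon> R\<^sup>\<epsilon>\<^sub>\<mu>\<^sub>\<sigma>\<close>.\<close>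

definition L_tensor :: "'n dconn \<Rightarrow> 'n::finite \<Rightarrow> 'n \<Rightarrow> 'n \<Rightarrow> 'n \<Rightarrow> 'n tmfun" where
  "L_tensor D \<alpha> \<nu> \<mu> \<sigma> z = (\<Sum>\<epsilon>\<in>UNIV. vcoef D \<alpha> \<nu> \<epsilon> z * N_curv (nlc D) \<epsilon> \<mu> \<sigma> z)"

section \<open>Well-definedness of the coframe and of the W-tensors\<close>

lemma coframe_dual:
  fixes lam :: "'n::finite \<Rightarrow> 'n \<Rightarrow> 'n tmfun"
  assumes indep: "\<And>a :: 'n \<Rightarrow> real.
    (\<Sum>i\<in>UNIV. a i *\<^sub>R (\<chi> \<alpha>. lam i \<alpha> z)) = 0 \<Longrightarrow> \<forall>i. a i = 0"
  shows "(\<Sum>\<alpha>\<in>UNIV. lam i \<alpha> z * coframe lam j \<alpha> z) = (if i = j then 1 else 0)"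
    and "(\<Sum>k\<in>UNIV. lam k \<alpha> z * coframe lam k \<beta> z) = (if \<alpha> = \<beta> then 1 else 0)"
proof -
  let ?L = "\<chi> i \<alpha>. lam i \<alpha> z"
  have "\<forall>c. (\<Sum>i\<in>UNIV. c i *s row i ?L) = 0 \<longrightarrow> (\<forall>i. c i = 0)"
  proof (intro allI impI)
    fix c :: "'n \<Rightarrow> real" and i
    assume "(\<Sum>i\<in>UNIV. c i *s row i ?L) = 0"
    then have "(\<Sum>i\<in>UNIV. c i *\<^sub>R (\<chi> \<alpha>. lam i \<alpha> z)) = 0"
      by (simp add: row_def scalar_mult_eq_scaleR)
    then show "c i = 0"
      using indep by blast
  qed
  then have "\<exists>B. ?L ** B = mat 1"
    by (simp only: matrix_right_invertible_independent_rows)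
  then have "invertible ?L"
    by (simp add: invertible_right_inverse)
  then have inverse: "?L ** matrix_inv ?L = mat 1 \<and> matrix_inv ?L ** ?L = mat 1"
    unfolding matrix_inv_def invertible_def by (rule someI_ex)
  have "(?L ** matrix_inv ?L) $ i $ j = mat 1 $ i $ j"
    using inverse by simp
  then show "(\<Sum>\<alpha>\<in>UNIV. lam i \<alpha> z * coframe lam j \<alpha> z) = (if i = j then 1 else 0)"
    by (simp add: coframe_def matrix_matrix_mult_def mat_def)
  have "(matrix_inv ?L ** ?L) $ \<beta> $ \<alpha> = mat 1 $ \<beta> $ \<alpha>"
    using inverse by simp
  then show "(\<Sum>k\<in>UNIV. lam k \<alpha> z * coframe lam k \<beta> z) = (if \<alpha> = \<beta> then 1 else 0)"
    by (auto simp add: coframe_def matrix_matrix_mult_def mat_def mult.commute)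
qed

lemma W_ex1:
  fixes lam :: "'n::finite \<Rightarrow> 'n \<Rightarrow> 'n tmfun" and K :: "'n \<Rightarrow> 'n \<Rightarrow> 'n \<Rightarrow> 'n \<Rightarrow> real"
  assumes indep: "\<And>a :: 'n \<Rightarrow> real.
    (\<Sum>i\<in>UNIV. a i *\<^sub>R (\<chi> \<alpha>. lam i \<alpha> z)) = 0 \<Longrightarrow> \<forall>i. a i = 0"
  shows "\<exists>!H. \<forall>i \<mu> \<nu> \<sigma>. K i \<mu> \<nu> \<sigma> = (\<Sum>\<epsilon>\<in>UNIV. coframe lam i \<epsilon> z * H \<epsilon> \<mu> \<nu> \<sigma>)"
proof (rule ex1I)
  show "\<forall>i \<mu> \<nu> \<sigma>. K i \<mu> \<nu> \<sigma> =
    (\<Sum>\<epsilon>\<in>UNIV. coframe lam i \<epsilon> z * (\<Sum>j\<in>UNIV. lam j \<epsilon> z * K j \<mu> \<nu> \<sigma>))"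
  proof (intro allI)
    fix i \<mu> \<nu> \<sigma>
    have "(\<Sum>\<epsilon>\<in>UNIV. coframe lam i \<epsilon> z * (\<Sum>j\<in>UNIV. lam j \<epsilon> z * K j \<mu> \<nu> \<sigma>)) =
      (\<Sum>\<epsilon>\<in>UNIV. \<Sum>j\<in>UNIV. lam j \<epsilon> z * coframe lam i \<epsilon> z * K j \<mu> \<nu> \<sigma>)"
      by (simp add: sum_distrib_left mult_ac)
    also have "\<dots> = (\<Sum>j\<in>UNIV. \<Sum>\<epsilon>\<in>UNIV. lam j \<epsilon> z * coframe lam i \<epsilon> z * K j \<mu> \<nu> \<sigma>)"
      by (rule sum.swap)
    also have "\<dots> = (\<Sum>j\<in>UNIV. (\<Sum>\<epsilon>\<in>UNIV. lam j \<epsilon> z * coframe lam i \<epsilon> z) * K j \<mu> \<nu> \<sigma>)"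
      by (simp add: sum_distrib_right)
    also have "\<dots> = K i \<mu> \<nu> \<sigma>"
      by (simp add: coframe_dual(1)[OF indep] if_distrib[of "\<lambda>x. x * _"] cong: if_cong)
    finally show "K i \<mu> \<nu> \<sigma> =
      (\<Sum>\<epsilon>\<in>UNIV. coframe lam i \<epsilon> z * (\<Sum>j\<in>UNIV. lam j \<epsilon> z * K j \<mu> \<nu> \<sigma>))" by simp
  qed
next
  fix H
  assume H: "\<forall>i \<mu> \<nu> \<sigma>. K i \<mu> \<nu> \<sigma> = (\<Sum>\<epsilon>\<in>UNIV. coframe lam i \<epsilon> z * H \<epsilon> \<mu> \<nu> \<sigma>)"
  show "H = (\<lambda>\<alpha> \<mu> \<nu> \<sigma>. \<Sum>j\<in>UNIV. lam j \<alpha> z * K j \<mu> \<nu> \<sigma>)"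
  proof (intro ext)
    fix \<alpha> \<mu> \<nu> \<sigma>
    have "(\<Sum>j\<in>UNIV. lam j \<alpha> z * K j \<mu> \<nu> \<sigma>) =
      (\<Sum>j\<in>UNIV. \<Sum>\<epsilon>\<in>UNIV. lam j \<alpha> z * coframe lam j \<epsilon> z * H \<epsilon> \<mu> \<nu> \<sigma>)"
      by (simp add: H[rule_format] sum_distrib_left mult_ac)
    also have "\<dots> = (\<Sum>\<epsilon>\<in>UNIV. \<Sum>j\<in>UNIV. lam j \<alpha> z * coframe lam j \<epsilon> z * H \<epsilon> \<mu> \<nu> \<sigma>)"
      by (rule sum.swap)
    also have "\<dots> = (\<Sum>\<epsilon>\<in>UNIV. (\<Sum>j\<in>UNIV. lam j \<alpha> z * coframe lam j \<epsilon> z) * H \<epsilon> \<mu> \<nu> \<sigma>)"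
      by (simp add: sum_distrib_right)
    also have "\<dots> = H \<alpha> \<mu> \<nu> \<sigma>"
      by (simp add: coframe_dual(2)[OF indep] if_distrib[of "\<lambda>x. x * _"] cong: if_cong)
    finally show "H \<alpha> \<mu> \<nu> \<sigma> = (\<Sum>j\<in>UNIV. lam j \<alpha> z * K j \<mu> \<nu> \<sigma>)" by simp
  qed
qed

lemma gap_space_indep:
  fixes \<A> :: "('m::{t2_space, second_countable_topology}, 'n::finite) chart set"
  assumes "gap_space \<A> lam" "c \<in> \<A>" "z \<in> induced_range c"
    and "(\<Sum>i\<in>UNIV. (a :: 'n \<Rightarrow> real) i *\<^sub>R (\<chi> \<alpha>. lam c i \<alpha> z)) = 0"
  shows "\<forall>i. a i = 0"
  using assms unfolding gap_space_def by blast

lemma hW_tensor_eq: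
  fixes lam :: "'n::finite \<Rightarrow> 'n \<Rightarrow> 'n tmfun"
  assumes indep: "\<And>a :: 'n \<Rightarrow> real.
    (\<Sum>i\<in>UNIV. a i *\<^sub>R (\<chi> \<alpha>. lam i \<alpha> z)) = 0 \<Longrightarrow> \<forall>i. a i = 0"
  shows "hcov02 D (hcov01 D (coframe lam i)) \<mu> \<nu> \<sigma> z - hcov02 D (hcov01 D (coframe lam i)) \<mu> \<sigma> \<nu> z =
    (\<Sum>\<epsilon>\<in>UNIV. coframe lam i \<epsilon> z * hW_tensor D lam \<epsilon> \<mu> \<nu> \<sigma> z)"
  using theI'[OF W_ex1[OF indep, where K = "\<lambda>i \<mu> \<nu> \<sigma>. hcov02 D (hcov01 D (coframe lam i)) \<mu> \<nu> \<sigma> z -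
      hcov02 D (hcov01 D (coframe lam i)) \<mu> \<sigma> \<nu> z"]]
  unfolding hW_tensor_def by blast

lemma hW_tensor_eqI:
  fixes lam :: "'n::finite \<Rightarrow> 'n \<Rightarrow> 'n tmfun"
  assumes indep: "\<And>a :: 'n \<Rightarrow> real.
    (\<Sum>i\<in>UNIV. a i *\<^sub>R (\<chi> \<alpha>. lam i \<alpha> z)) = 0 \<Longrightarrow> \<forall>i. a i = 0"
    and H: "\<And>i \<mu> \<nu> \<sigma>. hcov02 D (hcov01 D (coframe lam i)) \<mu> \<nu> \<sigma> z -
      hcov02 D (hcov01 D (coframe lam i)) \<mu> \<sigma> \<nu> z = (\<Sum>\<epsilon>\<in>UNIV. coframe lam i \<epsilon> z * H \<epsilon> \<mu> \<nu> \<sigma>)"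
  shows "hW_tensor D lam \<alpha> \<mu> \<nu> \<sigma> z = H \<alpha> \<mu> \<nu> \<sigma>"
  unfolding hW_tensor_def
  using the1_equality[OF W_ex1[OF indep, where K = "\<lambda>i \<mu> \<nu> \<sigma>.
      hcov02 D (hcov01 D (coframe lam i)) \<mu> \<nu> \<sigma> z - hcov02 D (hcov01 D (coframe lam i)) \<mu> \<sigma> \<nu> z"],
      where a = H] H by simp

lemma vW_tensor_eq:
  fixes lam :: "'n::finite \<Rightarrow> 'n \<Rightarrow> 'n tmfun"
  assumes indep: "\<And>a :: 'n \<Rightarrow> real.
    (\<Sum>i\<in>UNIV. a i *\<^sub>R (\<chi> \<alpha>. lam i \<alpha> z)) = 0 \<Longrightarrow> \<forall>i. a i = 0"
  shows "vcov02 D (vcov01 D (coframe lam i)) \<mu> \<nu> \<sigma> z - vcov02 D (vcov01 D (coframe lam i)) \<mu> \<sigma> \<nu> z =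
    (\<Sum>\<epsilon>\<in>UNIV. coframe lam i \<epsilon> z * vW_tensor D lam \<epsilon> \<mu> \<nu> \<sigma> z)"
  using theI'[OF W_ex1[OF indep, where K = "\<lambda>i \<mu> \<nu> \<sigma>. vcov02 D (vcov01 D (coframe lam i)) \<mu> \<nu> \<sigma> z -
      vcov02 D (vcov01 D (coframe lam i)) \<mu> \<sigma> \<nu> z"]]
  unfolding vW_tensor_def by blast

lemma vW_tensor_eqI:
  fixes lam :: "'n::finite \<Rightarrow> 'n \<Rightarrow> 'n tmfun"
  assumes indep: "\<And>a :: 'n \<Rightarrow> real.
    (\<Sum>i\<in>UNIV. a i *\<^sub>R (\<chi> \<alpha>. lam i \<alpha> z)) = 0 \<Longrightarrow> \<forall>i. a i = 0"
    and V: "\<And>i \<mu> \<nu> \<sigma>. vcov02 D (vcov01 D (coframe lam i)) \<mu> \<nu> \<sigma> z -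
      vcov02 D (vcov01 D (coframe lam i)) \<mu> \<sigma> \<nu> z = (\<Sum>\<epsilon>\<in>UNIV. coframe lam i \<epsilon> z * V \<epsilon> \<mu> \<nu> \<sigma>)"
  shows "vW_tensor D lam \<alpha> \<mu> \<nu> \<sigma> z = V \<alpha> \<mu> \<nu> \<sigma>"
  unfolding vW_tensor_def
  using the1_equality[OF W_ex1[OF indep, where K = "\<lambda>i \<mu> \<nu> \<sigma>.
      vcov02 D (vcov01 D (coframe lam i)) \<mu> \<nu> \<sigma> z - vcov02 D (vcov01 D (coframe lam i)) \<mu> \<sigma> \<nu> z"],
      where a = V] V by simp

end

theory Submission
  imports Defs
begin

text \<open>Write \<open>S = \<Gamma> - G\<close> for the difference between the canonical coefficients \<open>\<Gamma>\<close> and those of another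
  d-connection \<open>G\<close> over the same \<open>N\<close>. As \<open>\<delta>\<^sub>\<nu>\<lambda>\<^sub>\<mu> = \<lambda>\<^sub>\<epsilon>\<Gamma>\<^sup>\<epsilon>\<^sub>\<mu>\<^sub>\<nu>\<close>, the coframe satisfies
  \<open>\<lambda>\<^sub>\<mu>\<^sub>|\<^sub>\<nu> = \<lambda>\<^sub>\<epsilon>S\<^sup>\<epsilon>\<^sub>\<mu>\<^sub>\<nu>\<close> with respect to \<open>G\<close>, so its W-tensor is
  \<open>S\<^sup>\<alpha>\<^sub>\<mu>\<^sub>\<nu>\<^sub>|\<^sub>\<sigma> + S\<^sup>\<alpha>\<^sub>\<epsilon>\<^sub>\<nu>S\<^sup>\<epsilon>\<^sub>\<mu>\<^sub>\<sigma> + S\<^sup>\<alpha>\<^sub>\<mu>\<^sub>\<epsilon>S\<^sup>\<epsilon>\<^sub>\<nu>\<^sub>\<sigma>\<close> minus the same with \<open>\<nu>\<close> and \<open>\<sigma>\<close>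
  interchanged, where \<open>|\<close> is now canonical. With \<open>s\<^sub>\<mu> = S\<^sup>\<alpha>\<^sub>\<mu>\<^sub>\<alpha>\<close> the contraction of this is
  \<open>s\<^sub>\<mu>\<^sub>|\<^sub>\<sigma> - S\<^sup>\<alpha>\<^sub>\<mu>\<^sub>\<sigma>\<^sub>|\<^sub>\<alpha> + s\<^sub>\<epsilon>S\<^sup>\<epsilon>\<^sub>\<mu>\<^sub>\<sigma> - S\<^sup>\<epsilon>\<^sub>\<sigma>\<^sub>\<alpha>S\<^sup>\<alpha>\<^sub>\<mu>\<^sub>\<epsilon>\<close>.
  For \<open>S = \<gamma>\<close> this is (d). For \<open>S = \<Lambda>\<close> the first Bianchi identity, whose right-hand side contains
  \<open>L\<close> because \<open>[\<delta>\<^sub>\<sigma>, \<delta>\<^sub>\<nu>]\<close> is \<open>R\<^sup>\<epsilon>\<^sub>\<sigma>\<^sub>\<nu>\<close> times the vertical derivations, turns it into (a); the vertical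
  derivations commute, which gives (b) in the same way; \<open>S = \<Lambda>/2\<close> gives (c).\<close>

section \<open>Smooth functions\<close>

lemma frechet_derivative_add_at:
  assumes "f differentiable (at x)" "g differentiable (at x)"
  shows "frechet_derivative (\<lambda>x. f x + g x) (at x) v = frechet_derivative f (at x) v + frechet_derivative g (at x) v"
proof -
  have "(f has_derivative frechet_derivative f (at x)) (at x)"
    "(g has_derivative frechet_derivative g (at x)) (at x)"
    using assms by (simp_all add: frechet_derivative_works)
  from has_derivative_add[OF this] show ?thesis
    by (simp add: frechet_derivative_at[symmetric])
qed

lemma frechet_derivative_mult_at:
  fixes f g :: "'a::real_normed_vector \<Rightarrow> real"
  assumes "f differentiable (at x)" "g differentiable (at x)"
  shows "frechet_derivative (\<lambda>x. f x * g x) (at x) v =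
    f x * frechet_derivative g (at x) v + frechet_derivative f (at x) v * g x"
proof -
  have "(f has_derivative frechet_derivative f (at x)) (at x)"
    "(g has_derivative frechet_derivative g (at x)) (at x)"
    using assms by (simp_all add: frechet_derivative_works)
  from has_derivative_mult[OF this] show ?thesis
    by (simp add: frechet_derivative_at[symmetric])
qed

lemma frechet_derivative_inverse_at:
  fixes f :: "'a::real_normed_vector \<Rightarrow> real"
  assumes "f differentiable (at x)" "f x \<noteq> 0"
  shows "frechet_derivative (\<lambda>x. inverse (f x)) (at x) v =
    - (inverse (f x) * frechet_derivative f (at x) v * inverse (f x))"
proof -
  have "(f has_derivative frechet_derivative f (at x)) (at x)"
    using assms by (simp add: frechet_derivative_works)
  from Deriv.has_derivative_inverse[OF assms(2) this] show ?thesis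
    by (simp add: frechet_derivative_at[symmetric])
qed

text \<open>\<open>frechet_derivative\<close> chooses among the derivatives at the point. Functions
  that agree near the point have the same derivatives there, so the choices coincide even where no
  derivative exists.\<close>

lemma frechet_derivative_cong_open:
  assumes "open S" "x \<in> S" "\<And>y. y \<in> S \<Longrightarrow> f y = g y"
  shows "frechet_derivative f (at x) = frechet_derivative g (at x)"
proof -
  have "(f has_derivative D) (at x) \<longleftrightarrow> (g has_derivative D) (at x)" for D
    using has_derivative_transform_within_open[OF _ assms(1,2)] assms(3) by metis
  then show ?thesis
    by (simp add: frechet_derivative_def)
qed

lemma differentiable_cong_open:
  assumes "open S" "x \<in> S" "\<And>y. y \<in> S \<Longrightarrow> f y = g y" "f differentiable (at x)"
  shows "g differentiable (at x)"
  using assms has_derivative_transform_within_open unfolding differentiable_def by metis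

section \<open>Closure properties of C^k and smooth functions\<close>

lemma C_k_on_cong:
  assumes "open S" "\<And>y. y \<in> S \<Longrightarrow> f y = g y" "C_k_on k f S"
  shows "C_k_on k g S"
  using assms(2,3)
proof (induction k arbitrary: f g)
  case 0
  then show ?case using continuous_on_cong by force
next
  case (Suc k)
  show ?case
    unfolding C_k_on.simps
  proof (intro conjI ballI allI)
    fix x assume "x \<in> S"
    then show "g differentiable (at x)"
      using Suc.prems differentiable_cong_open[OF assms(1)] by (metis C_k_on.simps(2))
  next
    fix v
    show "C_k_on k (\<lambda>x. frechet_derivative g (at x) v) S"
    proof (rule Suc.IH)
      show "C_k_on k (\<lambda>x. frechet_derivative f (at x) v) S"
        using Suc.prems by simp
    qed (use frechet_derivative_cong_open[OF assms(1)] Suc.prems(1) in metis)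
  qed
qed

text \<open>Continuity occurs only in the base clause of \<open>C_k_on\<close>; at that level it
  comes from differentiability, and higher orders pass to the derivatives.\<close>

lemma C_k_on_SucD: "C_k_on (Suc k) f S \<Longrightarrow> C_k_on k f S"
proof (induction k arbitrary: f)
  case 0
  then show ?case
    by (auto intro!: continuous_at_imp_continuous_on differentiable_imp_continuous_within)
next
  case (Suc k)
  then show ?case by (metis C_k_on.simps(2))
qed

lemma C_k_on_const: "C_k_on k (\<lambda>x. c) S"
  by (induction k arbitrary: c) auto

lemma C_k_on_add:
  assumes "open S" "C_k_on k f S" "C_k_on k g S"
  shows "C_k_on k (\<lambda>x. f x + g x) S"
  using assms(2,3)
proof (induction k arbitrary: f g)
  case 0
  then show ?case by (auto intro: continuous_on_add)
next
  case (Suc k)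
  have "C_k_on k (\<lambda>x. frechet_derivative (\<lambda>x. f x + g x) (at x) v) S" for v
  proof (rule C_k_on_cong[OF assms(1)])
    show "C_k_on k (\<lambda>x. frechet_derivative f (at x) v + frechet_derivative g (at x) v) S"
      using Suc.prems by (intro Suc.IH) auto
  qed (use Suc.prems frechet_derivative_add_at[of f _ g v] in auto)
  then show ?case using Suc.prems by auto
qed

text \<open>The Leibniz rule keeps one factor underived in each summand, so the induction hypothesis
  is applied to pairs whose underived member is first lowered to order \<open>k\<close>.\<close>

lemma C_k_on_mult:
  fixes f g :: "'a::real_normed_vector \<Rightarrow> real"
  assumes "open S" "C_k_on k f S" "C_k_on k g S"
  shows "C_k_on k (\<lambda>x. f x * g x) S"
  using assms(2,3)
proof (induction k arbitrary: f g)
  case 0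
  then show ?case by (auto intro: continuous_on_mult)
next
  case (Suc k)
  have "C_k_on k (\<lambda>x. frechet_derivative (\<lambda>x. f x * g x) (at x) v) S" for v
  proof (rule C_k_on_cong[OF assms(1)])
    show "C_k_on k (\<lambda>x. f x * frechet_derivative g (at x) v + frechet_derivative f (at x) v * g x) S"
      using Suc.prems C_k_on_SucD[OF Suc.prems(1)] C_k_on_SucD[OF Suc.prems(2)]
      by (intro C_k_on_add[OF assms(1)] Suc.IH) auto
  qed (use Suc.prems frechet_derivative_mult_at[of f _ g v] in auto)
  then show ?case using Suc.prems by auto
qed

text \<open>The derivative of the inverse is a product containing the inverse itself. The induction
  hypothesis supplies that factor at order \<open>k\<close>, and closure under products does the
  rest.\<close>

lemma C_k_on_inverse:
  fixes f :: "'a::real_normed_vector \<Rightarrow> real"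
  assumes "open S" "C_k_on k f S" "\<And>x. x \<in> S \<Longrightarrow> f x \<noteq> 0"
  shows "C_k_on k (\<lambda>x. inverse (f x)) S"
  using assms(2)
proof (induction k)
  case 0
  then show ?case using assms(3) by (auto intro: continuous_on_inverse)
next
  case (Suc k)
  have IH: "C_k_on k (\<lambda>x. inverse (f x)) S"
    using Suc.IH C_k_on_SucD[OF Suc.prems] by blast
  have "C_k_on k (\<lambda>x. frechet_derivative (\<lambda>x. inverse (f x)) (at x) v) S" for v
  proof (rule C_k_on_cong[OF assms(1)])
    show "C_k_on k (\<lambda>x. (-1) * (inverse (f x) * frechet_derivative f (at x) v * inverse (f x))) S"
      using Suc.prems by (intro C_k_on_mult[OF assms(1)] C_k_on_const IH) auto
  qed (use Suc.prems frechet_derivative_inverse_at[of f _ v] assms(3) in auto)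
  then show ?case using Suc.prems assms(3) by (auto intro!: derivative_intros)
qed

lemma smooth_on_cong:
  "open S \<Longrightarrow> (\<And>y. y \<in> S \<Longrightarrow> f y = g y) \<Longrightarrow> smooth_on f S \<Longrightarrow> smooth_on g S"
  unfolding smooth_on_def using C_k_on_cong by blast

lemma smooth_on_differentiable: "smooth_on f S \<Longrightarrow> x \<in> S \<Longrightarrow> f differentiable (at x)"
  unfolding smooth_on_def by (metis C_k_on.simps(2))

lemma smooth_on_frechet_derivative:
  "smooth_on f S \<Longrightarrow> smooth_on (\<lambda>x. frechet_derivative f (at x) v) S"
  unfolding smooth_on_def by (metis C_k_on.simps(2))

lemma smooth_on_const: "smooth_on (\<lambda>x. c) S"
  by (simp add: smooth_on_def C_k_on_const)

lemma smooth_on_add: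
  "open S \<Longrightarrow> smooth_on f S \<Longrightarrow> smooth_on g S \<Longrightarrow> smooth_on (\<lambda>x. f x + g x) S"
  by (simp add: smooth_on_def C_k_on_add)

lemma smooth_on_mult:
  fixes f g :: "'a::real_normed_vector \<Rightarrow> real"
  shows "open S \<Longrightarrow> smooth_on f S \<Longrightarrow> smooth_on g S \<Longrightarrow> smooth_on (\<lambda>x. f x * g x) S"
  by (simp add: smooth_on_def C_k_on_mult)

lemma smooth_on_inverse:
  fixes f :: "'a::real_normed_vector \<Rightarrow> real"
  shows "open S \<Longrightarrow> smooth_on f S \<Longrightarrow> (\<And>x. x \<in> S \<Longrightarrow> f x \<noteq> 0) \<Longrightarrow> smooth_on (\<lambda>x. inverse (f x)) S"
  by (simp add: smooth_on_def C_k_on_inverse)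

lemma smooth_on_diff:
  fixes f g :: "'a::real_normed_vector \<Rightarrow> real"
  assumes "open S" "smooth_on f S" "smooth_on g S"
  shows "smooth_on (\<lambda>x. f x - g x) S"
  using smooth_on_add[OF assms(1,2) smooth_on_mult[OF assms(1) smooth_on_const[of "-1"] assms(3)]] by simp

lemma smooth_on_sum:
  assumes "open S" "\<And>i. i \<in> I \<Longrightarrow> smooth_on (f i) S"
  shows "smooth_on (\<lambda>x. \<Sum>i\<in>I. f i x) S"
  using assms(2)
  by (induction I rule: infinite_finite_induct) (auto intro!: smooth_on_const smooth_on_add[OF assms(1)])

lemma smooth_on_prod:
  fixes f :: "'i \<Rightarrow> 'a::real_normed_vector \<Rightarrow> real"
  assumes "open S" "\<And>i. i \<in> I \<Longrightarrow> smooth_on (f i) S"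
  shows "smooth_on (\<lambda>x. \<Prod>i\<in>I. f i x) S"
  using assms(2)
  by (induction I rule: infinite_finite_induct) (auto intro!: smooth_on_const smooth_on_mult[OF assms(1)])

lemma smooth_on_det:
  fixes A :: "'n::finite \<Rightarrow> 'n \<Rightarrow> 'a::real_normed_vector \<Rightarrow> real"
  assumes "open S" "\<And>i j. smooth_on (A i j) S"
  shows "smooth_on (\<lambda>x. det (\<chi> i j. A i j x)) S"
  unfolding det_def
  by (auto intro!: smooth_on_sum smooth_on_mult smooth_on_prod smooth_on_const assms)

section \<open>Symmetry of second derivatives\<close>

text \<open>The chain rule along a line, which makes the one-variable mean value theorem
  available.\<close>

lemma has_real_derivative_along_line:
  fixes f :: "'a::real_normed_vector \<Rightarrow> real"
  assumes "f differentiable (at (x + t *\<^sub>R u))"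
  shows "((\<lambda>s. f (x + s *\<^sub>R u)) has_real_derivative frechet_derivative f (at (x + t *\<^sub>R u)) u) (at t)"
proof -
  let ?D = "frechet_derivative f (at (x + t *\<^sub>R u))"
  have D: "(f has_derivative ?D) (at (x + t *\<^sub>R u))"
    using assms by (simp add: frechet_derivative_works)
  have "((\<lambda>s. x + s *\<^sub>R u) has_derivative (\<lambda>s. s *\<^sub>R u)) (at t)"
    by (auto intro!: derivative_eq_intros)
  from diff_chain_at[OF this D] have "((\<lambda>s. f (x + s *\<^sub>R u)) has_derivative (\<lambda>s. ?D (s *\<^sub>R u))) (at t)"
    by (simp add: o_def)
  moreover have "?D (s *\<^sub>R u) = ?D u * s" for s
    using linear_cmul[OF has_derivative_linear[OF D]] by simp
  ultimately show ?thesis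
    by (simp add: has_field_derivative_def)
qed

text \<open>The second difference is the increment over \<open>[0, h]\<close> of
  \<open>s \<mapsto> f (x + h v + s u) - f (x + s u)\<close>. The mean value theorem in
  \<open>s\<close> leaves an increment of the \<open>u\<close>-derivative in direction
  \<open>v\<close>, to which it is applied once more.\<close>

lemma second_difference_mean_value:
  fixes f :: "'a::real_normed_vector \<Rightarrow> real"
  assumes f: "\<And>y. y \<in> S \<Longrightarrow> f differentiable (at y)"
    and f': "\<And>y. y \<in> S \<Longrightarrow> (\<lambda>y. frechet_derivative f (at y) u) differentiable (at y)"
    and S: "\<And>s t. \<lbrakk>0 \<le> s; s \<le> h; 0 \<le> t; t \<le> h\<rbrakk> \<Longrightarrow> x + s *\<^sub>R u + t *\<^sub>R v \<in> S" and "0 < h"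
  shows "\<exists>s t. 0 < s \<and> s < h \<and> 0 < t \<and> t < h \<and>
    f (x + h *\<^sub>R u + h *\<^sub>R v) - f (x + h *\<^sub>R u) - f (x + h *\<^sub>R v) + f x =
    h * h * frechet_derivative (\<lambda>y. frechet_derivative f (at y) u) (at (x + s *\<^sub>R u + t *\<^sub>R v)) v"
proof -
  let ?f' = "\<lambda>y. frechet_derivative f (at y) u"
  have "\<exists>s>0. s < h \<and> (f ((x + h *\<^sub>R v) + h *\<^sub>R u) - f (x + h *\<^sub>R u)) - (f ((x + h *\<^sub>R v) + 0 *\<^sub>R u) - f (x + 0 *\<^sub>R u))
      = (h - 0) * (?f' ((x + h *\<^sub>R v) + s *\<^sub>R u) - ?f' (x + s *\<^sub>R u))"
  proof (rule MVT2[OF \<open>0 < h\<close>])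
    fix s assume s: "0 \<le> s" "s \<le> h"
    show "((\<lambda>s. f ((x + h *\<^sub>R v) + s *\<^sub>R u) - f (x + s *\<^sub>R u)) has_real_derivative
        (?f' ((x + h *\<^sub>R v) + s *\<^sub>R u) - ?f' (x + s *\<^sub>R u))) (at s)"
    proof (intro DERIV_diff has_real_derivative_along_line f)
      show "x + h *\<^sub>R v + s *\<^sub>R u \<in> S" "x + s *\<^sub>R u \<in> S"
        using S[of s h] S[of s 0] s \<open>0 < h\<close> by (simp_all add: add_ac)
    qed
  qed
  then obtain s where s: "0 < s" "s < h"
    "f ((x + h *\<^sub>R v) + h *\<^sub>R u) - f (x + h *\<^sub>R u) - (f (x + h *\<^sub>R v) - f x)
      = h * (?f' ((x + h *\<^sub>R v) + s *\<^sub>R u) - ?f' (x + s *\<^sub>R u))"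
    by auto
  have "\<exists>t>0. t < h \<and> ?f' ((x + s *\<^sub>R u) + h *\<^sub>R v) - ?f' ((x + s *\<^sub>R u) + 0 *\<^sub>R v)
      = (h - 0) * frechet_derivative ?f' (at ((x + s *\<^sub>R u) + t *\<^sub>R v)) v"
    using s S by (intro MVT2[OF \<open>0 < h\<close>] has_real_derivative_along_line f') auto
  then obtain t where "0 < t" "t < h"
    "?f' ((x + s *\<^sub>R u) + h *\<^sub>R v) - ?f' (x + s *\<^sub>R u)
      = h * frechet_derivative ?f' (at ((x + s *\<^sub>R u) + t *\<^sub>R v)) v"
    by auto
  with s show ?thesis
    by (intro exI[of _ s] exI[of _ t]) (simp add: algebra_simps)
qed

text \<open>The second difference is symmetric in \<open>u\<close> and \<open>v\<close>, so the mean
  value formula in both orders makes the two mixed derivatives agree at points near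
  \<open>x\<close>, though not the same point. Continuity of both then bounds their gap at
  \<open>x\<close> by any \<open>e > 0\<close>.\<close>

lemma frechet_derivative_commute:
  fixes f :: "'a::real_normed_vector \<Rightarrow> real"
  assumes "open S" "x \<in> S" and f: "C_k_on 2 f S"
  shows "frechet_derivative (\<lambda>y. frechet_derivative f (at y) u) (at x) v =
    frechet_derivative (\<lambda>y. frechet_derivative f (at y) v) (at x) u"
proof -
  define p where "p u v y = frechet_derivative (\<lambda>y. frechet_derivative f (at y) u) (at y) v" for u v y
  have diff: "\<And>y. y \<in> S \<Longrightarrow> f differentiable (at y)"
      "\<And>y u. y \<in> S \<Longrightarrow> (\<lambda>y. frechet_derivative f (at y) u) differentiable (at y)"
    and cont: "\<And>u v. continuous_on S (p u v)"
    using f by (simp_all add: numeral_2_eq_2 p_def)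
  have small: "\<bar>p u v x - p v u x\<bar> \<le> e" if "e > 0" for e
  proof -
    have "isCont (p u v) x" "isCont (p v u) x"
      using cont assms(1,2) continuous_on_eq_continuous_at by blast+
    then obtain d1 d2 where d1: "d1 > 0" "\<And>y. dist y x < d1 \<Longrightarrow> \<bar>p u v y - p u v x\<bar> < e/2"
      and d2: "d2 > 0" "\<And>y. dist y x < d2 \<Longrightarrow> \<bar>p v u y - p v u x\<bar> < e/2"
      unfolding continuous_at_eps_delta using \<open>e > 0\<close> half_gt_zero by (metis dist_real_def)
    obtain d3 where d3: "d3 > 0" "ball x d3 \<subseteq> S"
      using assms(1,2) open_contains_ball by blast
    define d where "d = min d1 (min d2 d3)"
    have "d > 0" using d1 d2 d3 by (simp add: d_def)
    \<comment> \<open>This side length keeps the whole parallelogram spanned by \<open>h u\<close>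
      and \<open>h v\<close> within distance \<open>d\<close> of \<open>x\<close>. The summand 1
      keeps the denominator positive when \<open>u\<close> and \<open>v\<close> vanish.\<close>
    define h where "h = d / (2 * (norm u + norm v + 1))"
    have pos: "norm u + norm v + 1 > 0" by (simp add: add_nonneg_pos)
    then have "h > 0" using \<open>d > 0\<close> by (simp add: h_def)
    have "h * (norm u + norm v + 1) = d / 2"
      using pos unfolding h_def by (metis (no_types) less_irrefl mult.commute nonzero_mult_divide_mult_cancel_left2 times_divide_eq_right)
    then have hd: "h * norm u + h * norm v < d"
      using \<open>d > 0\<close> \<open>h > 0\<close> by (simp add: algebra_simps)
    have near: "dist (x + s *\<^sub>R u + t *\<^sub>R v) x < d" if "0 \<le> s" "s \<le> h" "0 \<le> t" "t \<le> h" for s t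
    proof -
      have "dist (x + s *\<^sub>R u + t *\<^sub>R v) x \<le> s * norm u + t * norm v"
        using norm_triangle_ineq[of "s *\<^sub>R u" "t *\<^sub>R v"] that by (simp add: dist_norm add.assoc)
      also have "\<dots> \<le> h * norm u + h * norm v"
        using that by (intro add_mono mult_right_mono) auto
      finally show ?thesis using hd by simp
    qed
    have near': "dist (x + t *\<^sub>R v + s *\<^sub>R u) x < d" if "0 \<le> s" "s \<le> h" "0 \<le> t" "t \<le> h" for s t
      using near[OF that] by (simp add: add_ac)
    have inS: "y \<in> S" if "dist y x < d" for y
      using that d3 by (auto simp: d_def dist_commute)
    obtain s t where st: "0 < s" "s < h" "0 < t" "t < h"
      "f (x + h *\<^sub>R u + h *\<^sub>R v) - f (x + h *\<^sub>R u) - f (x + h *\<^sub>R v) + f x = h * h * p u v (x + s *\<^sub>R u + t *\<^sub>R v)"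
      using second_difference_mean_value[where u = u, OF diff inS[OF near] \<open>0 < h\<close>] unfolding p_def by auto
    obtain s' t' where st': "0 < s'" "s' < h" "0 < t'" "t' < h"
      "f (x + h *\<^sub>R v + h *\<^sub>R u) - f (x + h *\<^sub>R v) - f (x + h *\<^sub>R u) + f x = h * h * p v u (x + s' *\<^sub>R v + t' *\<^sub>R u)"
      using second_difference_mean_value[where u = v, OF diff inS[OF near'] \<open>0 < h\<close>] unfolding p_def by auto
    have "h * h * p u v (x + s *\<^sub>R u + t *\<^sub>R v) = h * h * p v u (x + s' *\<^sub>R v + t' *\<^sub>R u)"
      unfolding st(5)[symmetric] st'(5)[symmetric] by (simp add: add.assoc add.commute[of "h *\<^sub>R v"])
    then have "p u v (x + s *\<^sub>R u + t *\<^sub>R v) = p v u (x + s' *\<^sub>R v + t' *\<^sub>R u)"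
      using \<open>h > 0\<close> by simp
    moreover have "\<bar>p u v (x + s *\<^sub>R u + t *\<^sub>R v) - p u v x\<bar> < e/2"
      using near[of s t] st by (intro d1) (auto simp: d_def)
    moreover have "\<bar>p v u (x + s' *\<^sub>R v + t' *\<^sub>R u) - p v u x\<bar> < e/2"
      using near'[of t' s'] st' by (intro d2) (auto simp: d_def)
    ultimately show ?thesis by linarith
  qed
  then have "p u v x = p v u x"
    using field_le_epsilon[of "\<bar>p u v x - p v u x\<bar>" 0] by force
  then show ?thesis by (simp add: p_def)
qed

section \<open>Frames and derivations\<close>

text \<open>Antisymmetrised in \<open>\<nu>\<close>, \<open>\<sigma>\<close>, this is the W-tensor of the connection with coefficients \<open>G - S\<close>
  whenever \<open>G\<close> is canonical.\<close>

definition W_expr ::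
  "('n \<Rightarrow> 'n tmfun \<Rightarrow> 'n tmfun) \<Rightarrow> ('n \<Rightarrow> 'n \<Rightarrow> 'n \<Rightarrow> 'n tmfun) \<Rightarrow>
   ('n \<Rightarrow> 'n \<Rightarrow> 'n \<Rightarrow> 'n tmfun) \<Rightarrow> 'n::finite \<Rightarrow> 'n \<Rightarrow> 'n \<Rightarrow> 'n \<Rightarrow> 'n tmfun" where
  "W_expr d G S \<alpha> \<mu> \<nu> \<sigma> z = cov12 d G S \<alpha> \<mu> \<nu> \<sigma> z
     + (\<Sum>\<epsilon>\<in>UNIV. S \<alpha> \<epsilon> \<nu> z * S \<epsilon> \<mu> \<sigma> z) + (\<Sum>\<epsilon>\<in>UNIV. S \<alpha> \<mu> \<epsilon> z * S \<epsilon> \<nu> \<sigma> z)"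

text \<open>Abstracts what \<open>delta N\<close> and \<open>pdy\<close> share, so that horizontal
  and vertical identities have one proof. Commutation is left out because the \<open>delta N\<close>
  need not commute. \<open>d_cong\<close> carries no smoothness condition: it rewrites a function
  under a derivation by an identity known only on \<open>\<Omega>\<close>.\<close>

locale derivation_family =
  fixes \<Omega> :: "((real^'n::finite) \<times> (real^'n)) set"
    and d :: "'n \<Rightarrow> 'n tmfun \<Rightarrow> 'n tmfun"
  assumes open_domain: "open \<Omega>"
    and d_smooth: "\<And>f \<mu>. smooth_on f \<Omega> \<Longrightarrow> smooth_on (d \<mu> f) \<Omega>"
    and d_cong: "\<And>f g \<mu> z. \<lbrakk>z \<in> \<Omega>; \<And>y. y \<in> \<Omega> \<Longrightarrow> f y = g y\<rbrakk> \<Longrightarrow> d \<mu> f z = d \<mu> g z"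
    and d_const: "\<And>c \<mu> z. z \<in> \<Omega> \<Longrightarrow> d \<mu> (\<lambda>z. c) z = 0"
    and d_add: "\<And>f g \<mu> z. \<lbrakk>z \<in> \<Omega>; smooth_on f \<Omega>; smooth_on g \<Omega>\<rbrakk> \<Longrightarrow>
      d \<mu> (\<lambda>z. f z + g z) z = d \<mu> f z + d \<mu> g z"
    and d_mult: "\<And>f g \<mu> z. \<lbrakk>z \<in> \<Omega>; smooth_on f \<Omega>; smooth_on g \<Omega>\<rbrakk> \<Longrightarrow>
      d \<mu> (\<lambda>z. f z * g z) z = f z * d \<mu> g z + d \<mu> f z * g z"
begin

lemmas smooth_intros = smooth_on_const smooth_on_add[OF open_domain] smooth_on_diff[OF open_domain]
  smooth_on_mult[OF open_domain] smooth_on_sum[OF open_domain] d_smooth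

lemma d_cmult:
  assumes "z \<in> \<Omega>" "smooth_on f \<Omega>"
  shows "d \<mu> (\<lambda>z. c * f z) z = c * d \<mu> f z"
  using d_mult[OF assms(1) smooth_on_const assms(2)] d_const[OF assms(1)] by simp

lemma d_diff:
  assumes "z \<in> \<Omega>" "smooth_on f \<Omega>" "smooth_on g \<Omega>"
  shows "d \<mu> (\<lambda>z. f z - g z) z = d \<mu> f z - d \<mu> g z"
proof -
  have "smooth_on (\<lambda>z. (-1) * g z) \<Omega>"
    using assms(3) by (intro smooth_intros)
  from d_add[OF assms(1,2) this] d_cmult[OF assms(1,3), of _ "-1"] show ?thesis
    by simp
qed

lemma d_sum:
  assumes "z \<in> \<Omega>" "\<And>i. i \<in> I \<Longrightarrow> smooth_on (f i) \<Omega>"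
  shows "d \<mu> (\<lambda>z. \<Sum>i\<in>I. f i z) z = (\<Sum>i\<in>I. d \<mu> (f i) z)"
  using assms(2)
proof (induction I rule: infinite_finite_induct)
  case (insert i I)
  then show ?case
    by (simp add: d_add[OF assms(1)] smooth_intros)
qed (simp_all add: d_const assms(1))

end

locale frame_derivation = derivation_family \<Omega> d
  for \<Omega> :: "((real^'n::finite) \<times> (real^'n)) set" and d :: "'n \<Rightarrow> 'n tmfun \<Rightarrow> 'n tmfun" +
  fixes lam :: "'n \<Rightarrow> 'n \<Rightarrow> 'n tmfun"
  assumes lam_smooth: "\<And>i \<alpha>. smooth_on (lam i \<alpha>) \<Omega>"
    and lam_indep: "\<And>z a. \<lbrakk>z \<in> \<Omega>; (\<Sum>i\<in>UNIV. (a :: 'n \<Rightarrow> real) i *\<^sub>R (\<chi> \<alpha>. lam i \<alpha> z)) = 0\<rbrakk> \<Longrightarrow> \<forall>i. a i = 0"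
begin

lemmas lam_dual = coframe_dual[OF lam_indep]

text \<open>The components of \<open>\<lambda>_(j)\<close> with lower index solve the linear system
  with matrix \<open>?L z\<close> and right-hand side the \<open>j\<close>-th unit vector. Cramer's
  rule writes them as quotients of determinants with smooth entries.\<close>

lemma coframe_smooth: "smooth_on (coframe lam j \<mu>) \<Omega>"
proof (rule smooth_on_cong[OF open_domain])
  let ?L = "\<lambda>z. \<chi> i k. lam i k z"
  have inv: "det (?L z) \<noteq> 0 \<and> ?L z *v (\<chi> \<mu>. coframe lam j \<mu> z) = axis j 1" if "z \<in> \<Omega>" for z
  proof
    have "?L z ** (\<chi> \<mu> i. coframe lam i \<mu> z) = mat 1"
      by (simp add: vec_eq_iff matrix_matrix_mult_def mat_def lam_dual(1)[OF that])
    then show "det (?L z) \<noteq> 0"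
      using invertible_det_nz invertible_right_inverse by blast
    show "?L z *v (\<chi> \<mu>. coframe lam j \<mu> z) = axis j 1"
      by (simp add: vec_eq_iff matrix_vector_mult_def axis_def lam_dual(1)[OF that])
  qed
  \<comment> \<open>The numerator matrix of Cramer's rule: column \<open>\<mu>\<close> of the frame
    matrix is replaced by the right-hand side.\<close>
  let ?A = "\<lambda>i k z. if k = \<mu> then axis j 1 $ i else lam i k z"
  have "smooth_on (?A i k) \<Omega>" for i k
    by (cases "k = \<mu>") (simp_all add: smooth_intros lam_smooth)
  then show "smooth_on (\<lambda>z. det (\<chi> i k. ?A i k z) * inverse (det (?L z))) \<Omega>"
    by (intro smooth_intros lam_smooth smooth_on_det[OF open_domain] smooth_on_inverse[OF open_domain])
      (use inv in auto)
  fix z assume "z \<in> \<Omega>"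
  from inv[OF this] have "(\<chi> \<mu>. coframe lam j \<mu> z) =
      (\<chi> k. det (\<chi> i l. if l = k then axis j 1 $ i else ?L z $ i $ l) / det (?L z))"
    using cramer by blast
  then have "(\<chi> \<mu>. coframe lam j \<mu> z) $ \<mu> =
      (\<chi> k. det (\<chi> i l. if l = k then axis j 1 $ i else ?L z $ i $ l) / det (?L z)) $ \<mu>"
    by (rule arg_cong)
  then show "det (\<chi> i k. ?A i k z) * inverse (det (?L z)) = coframe lam j \<mu> z"
    by (simp add: divide_inverse cong: if_cong)
qed

lemma coframe_expand:
  assumes "z \<in> \<Omega>"
  shows "(\<Sum>\<epsilon>\<in>UNIV. coframe lam j \<epsilon> z * (\<Sum>i\<in>UNIV. lam i \<epsilon> z * F i)) = F j"
proof -
  have "(\<Sum>\<epsilon>\<in>UNIV. coframe lam j \<epsilon> z * (\<Sum>i\<in>UNIV. lam i \<epsilon> z * F i)) =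
      (\<Sum>\<epsilon>\<in>UNIV. \<Sum>i\<in>UNIV. (lam i \<epsilon> z * coframe lam j \<epsilon> z) * F i)"
    by (simp add: sum_distrib_left mult_ac)
  also have "\<dots> = (\<Sum>i\<in>UNIV. \<Sum>\<epsilon>\<in>UNIV. (lam i \<epsilon> z * coframe lam j \<epsilon> z) * F i)"
    by (rule sum.swap)
  also have "\<dots> = F j"
    by (simp add: sum_distrib_right[symmetric] lam_dual(1)[OF assms] if_distrib[of "\<lambda>x. x * _"] cong: if_cong)
  finally show ?thesis .
qed

lemma lam_coframe_expand:
  assumes "z \<in> \<Omega>"
  shows "(\<Sum>i\<in>UNIV. lam i \<alpha> z * (\<Sum>\<epsilon>\<in>UNIV. coframe lam i \<epsilon> z * F \<epsilon>)) = F \<alpha>"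
proof -
  have "(\<Sum>i\<in>UNIV. lam i \<alpha> z * (\<Sum>\<epsilon>\<in>UNIV. coframe lam i \<epsilon> z * F \<epsilon>)) =
      (\<Sum>i\<in>UNIV. \<Sum>\<epsilon>\<in>UNIV. (lam i \<alpha> z * coframe lam i \<epsilon> z) * F \<epsilon>)"
    by (simp add: sum_distrib_left mult_ac)
  also have "\<dots> = (\<Sum>\<epsilon>\<in>UNIV. \<Sum>i\<in>UNIV. (lam i \<alpha> z * coframe lam i \<epsilon> z) * F \<epsilon>)"
    by (rule sum.swap)
  also have "\<dots> = F \<alpha>"
    by (simp add: sum_distrib_right[symmetric] lam_dual(2)[OF assms] if_distrib[of "\<lambda>x. x * _"] cong: if_cong)
  finally show ?thesis .
qed

section \<open>The connection of the frame, and W-tensors in terms of difference tensors\<close>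

text \<open>The Weitzenboeck connection of the frame: \<open>\<Gamma>\<close> for
  \<open>d = delta N\<close> and \<open>C\<close> for \<open>d = pdy\<close>.\<close>

definition conn :: "'n \<Rightarrow> 'n \<Rightarrow> 'n \<Rightarrow> 'n tmfun" where
  "conn \<alpha> \<mu> \<nu> z = (\<Sum>i\<in>UNIV. lam i \<alpha> z * d \<nu> (coframe lam i \<mu>) z)"

definition tors :: "'n \<Rightarrow> 'n \<Rightarrow> 'n \<Rightarrow> 'n tmfun" where
  "tors \<alpha> \<mu> \<nu> z = conn \<alpha> \<mu> \<nu> z - conn \<alpha> \<nu> \<mu> z"

lemma conn_smooth: "smooth_on (conn \<alpha> \<mu> \<nu>) \<Omega>"
  unfolding conn_def by (intro smooth_intros lam_smooth coframe_smooth)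

lemma tors_smooth: "smooth_on (tors \<alpha> \<mu> \<nu>) \<Omega>"
  unfolding tors_def by (intro smooth_intros conn_smooth)

lemma d_coframe:
  assumes "z \<in> \<Omega>"
  shows "d \<nu> (coframe lam i \<mu>) z = (\<Sum>\<epsilon>\<in>UNIV. coframe lam i \<epsilon> z * conn \<epsilon> \<mu> \<nu> z)"
  unfolding conn_def using coframe_expand[OF assms] by simp

text \<open>The Leibniz rule together with parallelism of the coframe. It serves twice: with
  \<open>F\<close> a difference tensor for covariant derivatives of the coframe, and with
  \<open>F\<close> the coefficients \<open>conn\<close> for its second derivatives.\<close>

lemma d_coframe_sum:
  assumes "z \<in> \<Omega>" "\<And>\<epsilon>. smooth_on (F \<epsilon>) \<Omega>"
  shows "d \<sigma> (\<lambda>z. \<Sum>\<epsilon>\<in>UNIV. coframe lam i \<epsilon> z * F \<epsilon> z) z =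
    (\<Sum>\<alpha>\<in>UNIV. coframe lam i \<alpha> z * (d \<sigma> (F \<alpha>) z + (\<Sum>\<epsilon>\<in>UNIV. conn \<alpha> \<epsilon> \<sigma> z * F \<epsilon> z)))"
proof -
  have "d \<sigma> (\<lambda>z. \<Sum>\<epsilon>\<in>UNIV. coframe lam i \<epsilon> z * F \<epsilon> z) z =
      (\<Sum>\<epsilon>\<in>UNIV. coframe lam i \<epsilon> z * d \<sigma> (F \<epsilon>) z)
      + (\<Sum>\<epsilon>\<in>UNIV. (\<Sum>\<alpha>\<in>UNIV. coframe lam i \<alpha> z * conn \<alpha> \<epsilon> \<sigma> z) * F \<epsilon> z)"
    using assms by (simp add: d_sum d_mult coframe_smooth smooth_intros sum.distrib d_coframe)
  also have "(\<Sum>\<epsilon>\<in>UNIV. (\<Sum>\<alpha>\<in>UNIV. coframe lam i \<alpha> z * conn \<alpha> \<epsilon> \<sigma> z) * F \<epsilon> z) =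
      (\<Sum>\<epsilon>\<in>UNIV. \<Sum>\<alpha>\<in>UNIV. coframe lam i \<alpha> z * (conn \<alpha> \<epsilon> \<sigma> z * F \<epsilon> z))"
    by (simp add: sum_distrib_right mult.assoc)
  also have "\<dots> = (\<Sum>\<alpha>\<in>UNIV. \<Sum>\<epsilon>\<in>UNIV. coframe lam i \<alpha> z * (conn \<alpha> \<epsilon> \<sigma> z * F \<epsilon> z))"
    by (rule sum.swap)
  finally show ?thesis
    by (simp add: sum.distrib distrib_left sum_distrib_left)
qed

text \<open>For \<open>G = conn - S\<close> the \<open>conn\<close> part of the first covariant
  derivative cancels against the derivative of the coframe, leaving the components of
  \<open>S\<close>. In the second one, \<open>d_coframe_sum\<close> supplies the correction for the
  upper index, and putting \<open>conn - S\<close> for \<open>G\<close> in the two lower-index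
  corrections yields the canonical derivative of \<open>S\<close> plus two products.\<close>

lemma cov02_cov01_coframe:
  assumes "z \<in> \<Omega>" and S: "\<And>\<alpha> \<mu> \<nu>. smooth_on (S \<alpha> \<mu> \<nu>) \<Omega>"
    and G: "\<And>\<alpha> \<mu> \<nu> z. G \<alpha> \<mu> \<nu> z = conn \<alpha> \<mu> \<nu> z - S \<alpha> \<mu> \<nu> z"
  shows "cov02 d G (cov01 d G (coframe lam i)) \<mu> \<nu> \<sigma> z =
    (\<Sum>\<alpha>\<in>UNIV. coframe lam i \<alpha> z * W_expr d conn S \<alpha> \<mu> \<nu> \<sigma> z)"
proof -
  have cov01: "cov01 d G (coframe lam i) \<mu> \<nu> y = (\<Sum>\<epsilon>\<in>UNIV. coframe lam i \<epsilon> y * S \<epsilon> \<mu> \<nu> y)"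
    if "y \<in> \<Omega>" for y \<mu> \<nu>
    using that by (simp add: cov01_def G d_coframe right_diff_distrib sum_subtractf)
  have swap: "(\<Sum>\<epsilon>\<in>UNIV. (\<Sum>\<alpha>\<in>UNIV. coframe lam i \<alpha> z * F \<alpha> \<epsilon>) * H \<epsilon>) =
      (\<Sum>\<alpha>\<in>UNIV. coframe lam i \<alpha> z * (\<Sum>\<epsilon>\<in>UNIV. F \<alpha> \<epsilon> * H \<epsilon>))" for F H
    unfolding sum_distrib_right sum_distrib_left by (subst sum.swap) (simp add: mult_ac)
  have "cov02 d G (cov01 d G (coframe lam i)) \<mu> \<nu> \<sigma> z =
      d \<sigma> (\<lambda>y. \<Sum>\<epsilon>\<in>UNIV. coframe lam i \<epsilon> y * S \<epsilon> \<mu> \<nu> y) z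
      - (\<Sum>\<epsilon>\<in>UNIV. (\<Sum>\<alpha>\<in>UNIV. coframe lam i \<alpha> z * S \<alpha> \<epsilon> \<nu> z) * G \<epsilon> \<mu> \<sigma> z)
      - (\<Sum>\<epsilon>\<in>UNIV. (\<Sum>\<alpha>\<in>UNIV. coframe lam i \<alpha> z * S \<alpha> \<mu> \<epsilon> z) * G \<epsilon> \<nu> \<sigma> z)"
    using d_cong[OF assms(1), of "cov01 d G (coframe lam i) \<mu> \<nu>", OF cov01]
    by (simp add: cov02_def cov01 assms(1))
  also have "\<dots> = (\<Sum>\<alpha>\<in>UNIV. coframe lam i \<alpha> z *
      (d \<sigma> (S \<alpha> \<mu> \<nu>) z + (\<Sum>\<epsilon>\<in>UNIV. conn \<alpha> \<epsilon> \<sigma> z * S \<epsilon> \<mu> \<nu> z)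
       - (\<Sum>\<epsilon>\<in>UNIV. S \<alpha> \<epsilon> \<nu> z * G \<epsilon> \<mu> \<sigma> z) - (\<Sum>\<epsilon>\<in>UNIV. S \<alpha> \<mu> \<epsilon> z * G \<epsilon> \<nu> \<sigma> z)))"
    unfolding swap d_coframe_sum[OF assms(1) S] by (simp add: right_diff_distrib sum_subtractf)
  also have "\<dots> = (\<Sum>\<alpha>\<in>UNIV. coframe lam i \<alpha> z * W_expr d conn S \<alpha> \<mu> \<nu> \<sigma> z)"
    by (intro sum.cong refl arg_cong[where f = "\<lambda>x. _ * x"])
      (simp add: W_expr_def cov12_def G right_diff_distrib sum_subtractf mult.commute)
  finally show ?thesis .
qed

text \<open>The corrections for the upper index and for the lower index contracted with it cancel
  after exchanging the names of the summed indices.\<close>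

lemma cov01_contract:
  assumes "z \<in> \<Omega>" "\<And>\<alpha>. smooth_on (A \<alpha> \<mu> \<alpha>) \<Omega>"
  shows "cov01 d G (\<lambda>\<mu> z. \<Sum>\<alpha>\<in>UNIV. A \<alpha> \<mu> \<alpha> z) \<mu> \<sigma> z = (\<Sum>\<alpha>\<in>UNIV. cov12 d G A \<alpha> \<mu> \<alpha> \<sigma> z)"
proof -
  have "(\<Sum>\<alpha>\<in>UNIV. \<Sum>\<epsilon>\<in>UNIV. A \<epsilon> \<mu> \<alpha> z * G \<alpha> \<epsilon> \<sigma> z) = (\<Sum>\<alpha>\<in>UNIV. \<Sum>\<epsilon>\<in>UNIV. A \<alpha> \<mu> \<epsilon> z * G \<epsilon> \<alpha> \<sigma> z)"
    by (rule sum.swap)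
  moreover have "(\<Sum>\<epsilon>\<in>UNIV. (\<Sum>\<alpha>\<in>UNIV. A \<alpha> \<epsilon> \<alpha> z) * G \<epsilon> \<mu> \<sigma> z) =
      (\<Sum>\<alpha>\<in>UNIV. \<Sum>\<epsilon>\<in>UNIV. A \<alpha> \<epsilon> \<alpha> z * G \<epsilon> \<mu> \<sigma> z)"
    unfolding sum_distrib_right by (rule sum.swap)
  ultimately show ?thesis
    using assms by (simp add: cov01_def cov12_def d_sum sum.distrib sum_subtractf)
qed

text \<open>Antisymmetrisation gives four products of \<open>S\<close> with \<open>S\<close>. On
  contraction one becomes the trace term, two cancel by renaming summed indices, and the fourth is
  the final double sum.\<close>

lemma W_expr_contract:
  assumes "z \<in> \<Omega>" "\<And>\<alpha> \<mu> \<nu>. smooth_on (S \<alpha> \<mu> \<nu>) \<Omega>"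
  defines "s \<equiv> \<lambda>\<mu> z. \<Sum>\<alpha>\<in>UNIV. S \<alpha> \<mu> \<alpha> z"
  shows "(\<Sum>\<alpha>\<in>UNIV. W_expr d conn S \<alpha> \<mu> \<alpha> \<sigma> z - W_expr d conn S \<alpha> \<mu> \<sigma> \<alpha> z) =
    cov01 d conn s \<mu> \<sigma> z - (\<Sum>\<alpha>\<in>UNIV. cov12 d conn S \<alpha> \<mu> \<sigma> \<alpha> z)
    + (\<Sum>\<epsilon>\<in>UNIV. s \<epsilon> z * S \<epsilon> \<mu> \<sigma> z) - (\<Sum>\<alpha>\<in>UNIV. \<Sum>\<epsilon>\<in>UNIV. S \<epsilon> \<sigma> \<alpha> z * S \<alpha> \<mu> \<epsilon> z)"
proof -
  have 1: "(\<Sum>\<alpha>\<in>UNIV. \<Sum>\<epsilon>\<in>UNIV. S \<alpha> \<epsilon> \<alpha> z * S \<epsilon> \<mu> \<sigma> z) = (\<Sum>\<epsilon>\<in>UNIV. s \<epsilon> z * S \<epsilon> \<mu> \<sigma> z)"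
    unfolding s_def sum_distrib_right by (rule sum.swap)
  have 2: "(\<Sum>\<alpha>\<in>UNIV. \<Sum>\<epsilon>\<in>UNIV. S \<alpha> \<epsilon> \<sigma> z * S \<epsilon> \<mu> \<alpha> z) = (\<Sum>\<alpha>\<in>UNIV. \<Sum>\<epsilon>\<in>UNIV. S \<alpha> \<mu> \<epsilon> z * S \<epsilon> \<alpha> \<sigma> z)"
    by (subst sum.swap) (simp add: mult.commute)
  have 3: "cov01 d conn s \<mu> \<sigma> z = (\<Sum>\<alpha>\<in>UNIV. cov12 d conn S \<alpha> \<mu> \<alpha> \<sigma> z)"
    unfolding s_def by (rule cov01_contract[OF assms(1,2)])
  show ?thesis
    unfolding W_expr_def sum_subtractf sum.distrib 1 2 3
    by (simp add: mult.commute)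
qed

section \<open>Curvature of the frame connection and the first Bianchi identity, for derivations
  with commutator \<open>K\<close>\<close>

context
  fixes K :: "'n \<Rightarrow> 'n \<Rightarrow> 'n \<Rightarrow> 'n \<Rightarrow> real" and z
  assumes point: "z \<in> \<Omega>"
    and commutator: "\<And>i \<mu> \<nu> \<sigma>. d \<sigma> (d \<nu> (coframe lam i \<mu>)) z - d \<nu> (d \<sigma> (coframe lam i \<mu>)) z =
      (\<Sum>\<alpha>\<in>UNIV. coframe lam i \<alpha> z * K \<alpha> \<mu> \<sigma> \<nu>)"
begin

text \<open>Since the coframe is parallel, the curvature expression of \<open>conn\<close> is
  exactly what the commutator of the derivations leaves. Both sides are compared after contraction
  with the coframe, and the dual frame removes it.\<close>

lemma conn_curvature:
  "d \<sigma> (conn \<alpha> \<mu> \<nu>) z - d \<nu> (conn \<alpha> \<mu> \<sigma>) z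
    + (\<Sum>\<epsilon>\<in>UNIV. conn \<alpha> \<epsilon> \<sigma> z * conn \<epsilon> \<mu> \<nu> z) - (\<Sum>\<epsilon>\<in>UNIV. conn \<alpha> \<epsilon> \<nu> z * conn \<epsilon> \<mu> \<sigma> z) =
   K \<alpha> \<mu> \<sigma> \<nu>"
proof -
  let ?F = "\<lambda>\<alpha> \<mu> \<nu> \<sigma>. d \<sigma> (conn \<alpha> \<mu> \<nu>) z + (\<Sum>\<epsilon>\<in>UNIV. conn \<alpha> \<epsilon> \<sigma> z * conn \<epsilon> \<mu> \<nu> z)"
  have dd: "d \<sigma> (d \<nu> (coframe lam i \<mu>)) z = (\<Sum>\<alpha>\<in>UNIV. coframe lam i \<alpha> z * ?F \<alpha> \<mu> \<nu> \<sigma>)" for i \<mu> \<nu> \<sigma>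
    by (rule trans[OF d_cong[OF point d_coframe] d_coframe_sum[OF point conn_smooth]])
  have "(\<Sum>\<alpha>\<in>UNIV. coframe lam i \<alpha> z * (?F \<alpha> \<mu> \<nu> \<sigma> - ?F \<alpha> \<mu> \<sigma> \<nu>)) =
      (\<Sum>\<alpha>\<in>UNIV. coframe lam i \<alpha> z * K \<alpha> \<mu> \<sigma> \<nu>)" for i
    using commutator[of \<sigma> \<nu> i \<mu>] unfolding dd by (simp add: right_diff_distrib sum_subtractf)
  then have "?F \<alpha> \<mu> \<nu> \<sigma> - ?F \<alpha> \<mu> \<sigma> \<nu> = K \<alpha> \<mu> \<sigma> \<nu>"
    using lam_coframe_expand[OF point, of \<alpha> "\<lambda>\<alpha>. ?F \<alpha> \<mu> \<nu> \<sigma> - ?F \<alpha> \<mu> \<sigma> \<nu>"]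
      lam_coframe_expand[OF point, of \<alpha> "\<lambda>\<alpha>. K \<alpha> \<mu> \<sigma> \<nu>"] by simp
  then show ?thesis by simp
qed

text \<open>Each \<open>K\<close> is replaced by its curvature expression in \<open>conn\<close>.
  Both sides then consist of derivatives of \<open>conn\<close> and products of two of its
  coefficients, and these match term by term.\<close>

lemma Bianchi:
  "cov12 d conn tors \<alpha> \<mu> \<nu> \<sigma> z + cov12 d conn tors \<alpha> \<nu> \<sigma> \<mu> z + cov12 d conn tors \<alpha> \<sigma> \<mu> \<nu> z =
   K \<alpha> \<mu> \<sigma> \<nu> + K \<alpha> \<nu> \<mu> \<sigma> + K \<alpha> \<sigma> \<nu> \<mu>
   - (\<Sum>\<epsilon>\<in>UNIV. tors \<alpha> \<mu> \<epsilon> z * tors \<epsilon> \<nu> \<sigma> z + tors \<alpha> \<nu> \<epsilon> z * tors \<epsilon> \<sigma> \<mu> z + tors \<alpha> \<sigma> \<epsilon> z * tors \<epsilon> \<mu> \<nu> z)"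
proof -
  have d_tors: "d \<sigma> (tors \<alpha> \<mu> \<nu>) z = d \<sigma> (conn \<alpha> \<mu> \<nu>) z - d \<sigma> (conn \<alpha> \<nu> \<mu>) z" for \<alpha> \<mu> \<nu> \<sigma>
    unfolding tors_def by (rule d_diff[OF point conn_smooth conn_smooth])
  show ?thesis
    unfolding cov12_def d_tors conn_curvature[symmetric]
    by (simp add: tors_def sum.distrib sum_subtractf algebra_simps)
qed

lemma cov12_tors_swap: "cov12 d conn tors \<alpha> \<nu> \<mu> \<sigma> z = - cov12 d conn tors \<alpha> \<mu> \<nu> \<sigma> z"
proof -
  have "d \<sigma> (tors \<alpha> \<mu> \<nu>) z = d \<sigma> (conn \<alpha> \<mu> \<nu>) z - d \<sigma> (conn \<alpha> \<nu> \<mu>) z" for \<alpha> \<mu> \<nu> \<sigma>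
    unfolding tors_def by (rule d_diff[OF point conn_smooth conn_smooth])
  then show ?thesis
    by (simp only: cov12_def) (simp add: tors_def sum.distrib sum_subtractf algebra_simps)
qed

text \<open>\<open>Bianchi\<close> with \<open>\<nu>\<close> contracted against the upper index: of
  the three torsion products, two cancel after renaming and the third contains the trace
  \<open>b\<close>. The left-hand side is \<open>W_expr_contract\<close> for \<open>S = tors\<close>
  without its final double sum.\<close>

lemma Bianchi_contracted:
  defines "b \<equiv> \<lambda>\<mu> z. \<Sum>\<alpha>\<in>UNIV. tors \<alpha> \<mu> \<alpha> z"
  shows "cov01 d conn b \<mu> \<sigma> z - (\<Sum>\<alpha>\<in>UNIV. cov12 d conn tors \<alpha> \<mu> \<sigma> \<alpha> z)
      + (\<Sum>\<epsilon>\<in>UNIV. b \<epsilon> z * tors \<epsilon> \<mu> \<sigma> z) =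
    cov01 d conn b \<sigma> \<mu> z + (\<Sum>\<alpha>\<in>UNIV. K \<alpha> \<alpha> \<mu> \<sigma> + K \<alpha> \<mu> \<sigma> \<alpha> + K \<alpha> \<sigma> \<alpha> \<mu>)"
proof -
  have 1: "cov12 d conn tors \<alpha> \<mu> \<alpha> \<sigma> z - cov12 d conn tors \<alpha> \<sigma> \<alpha> \<mu> z - cov12 d conn tors \<alpha> \<mu> \<sigma> \<alpha> z =
      K \<alpha> \<mu> \<sigma> \<alpha> + K \<alpha> \<alpha> \<mu> \<sigma> + K \<alpha> \<sigma> \<alpha> \<mu>
      - ((\<Sum>\<epsilon>\<in>UNIV. tors \<alpha> \<mu> \<epsilon> z * tors \<epsilon> \<alpha> \<sigma> z) + (\<Sum>\<epsilon>\<in>UNIV. tors \<alpha> \<epsilon> \<alpha> z * tors \<epsilon> \<mu> \<sigma> z)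
        - (\<Sum>\<epsilon>\<in>UNIV. tors \<alpha> \<epsilon> \<sigma> z * tors \<epsilon> \<mu> \<alpha> z))" for \<alpha>
  proof -
    have "(\<Sum>\<epsilon>\<in>UNIV. tors \<alpha> \<mu> \<epsilon> z * tors \<epsilon> \<alpha> \<sigma> z + tors \<alpha> \<alpha> \<epsilon> z * tors \<epsilon> \<sigma> \<mu> z + tors \<alpha> \<sigma> \<epsilon> z * tors \<epsilon> \<mu> \<alpha> z) =
        (\<Sum>\<epsilon>\<in>UNIV. tors \<alpha> \<mu> \<epsilon> z * tors \<epsilon> \<alpha> \<sigma> z + tors \<alpha> \<epsilon> \<alpha> z * tors \<epsilon> \<mu> \<sigma> z - tors \<alpha> \<epsilon> \<sigma> z * tors \<epsilon> \<mu> \<alpha> z)"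
      by (intro sum.cong refl) (simp add: tors_def algebra_simps)
    with Bianchi[of \<alpha> \<mu> \<alpha> \<sigma>] show ?thesis
      by (simp add: cov12_tors_swap[of \<alpha> \<sigma> \<mu>] cov12_tors_swap[of \<alpha> \<alpha> \<sigma>] sum.distrib sum_subtractf)
  qed
  have 2: "(\<Sum>\<alpha>\<in>UNIV. \<Sum>\<epsilon>\<in>UNIV. tors \<alpha> \<epsilon> \<alpha> z * tors \<epsilon> \<mu> \<sigma> z) = (\<Sum>\<epsilon>\<in>UNIV. b \<epsilon> z * tors \<epsilon> \<mu> \<sigma> z)"
    unfolding b_def sum_distrib_right by (rule sum.swap)
  have 3: "(\<Sum>\<alpha>\<in>UNIV. \<Sum>\<epsilon>\<in>UNIV. tors \<alpha> \<epsilon> \<sigma> z * tors \<epsilon> \<mu> \<alpha> z) =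
      (\<Sum>\<alpha>\<in>UNIV. \<Sum>\<epsilon>\<in>UNIV. tors \<alpha> \<mu> \<epsilon> z * tors \<epsilon> \<alpha> \<sigma> z)"
    by (subst sum.swap) (simp add: mult.commute)
  have "(\<Sum>\<alpha>\<in>UNIV. cov12 d conn tors \<alpha> \<mu> \<alpha> \<sigma> z - cov12 d conn tors \<alpha> \<sigma> \<alpha> \<mu> z - cov12 d conn tors \<alpha> \<mu> \<sigma> \<alpha> z) =
      (\<Sum>\<alpha>\<in>UNIV. K \<alpha> \<mu> \<sigma> \<alpha> + K \<alpha> \<alpha> \<mu> \<sigma> + K \<alpha> \<sigma> \<alpha> \<mu>) - (\<Sum>\<epsilon>\<in>UNIV. b \<epsilon> z * tors \<epsilon> \<mu> \<sigma> z)"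
    unfolding 1 by (simp add: sum.distrib sum_subtractf 2 3)
  moreover have "cov01 d conn b \<mu> \<sigma> z = (\<Sum>\<alpha>\<in>UNIV. cov12 d conn tors \<alpha> \<mu> \<alpha> \<sigma> z)" for \<mu> \<sigma>
    unfolding b_def by (rule cov01_contract[OF point tors_smooth])
  ultimately show ?thesis
    by (simp add: sum.distrib sum_subtractf)
qed

text \<open>The common form of (a) and (b), with \<open>K\<close> equal to \<open>L\<close> and to 0
  respectively. Antisymmetry of the torsion turns the sign of the double sum.\<close>

lemma W_expr_tors_contract:
  defines "b \<equiv> \<lambda>\<mu> z. \<Sum>\<alpha>\<in>UNIV. tors \<alpha> \<mu> \<alpha> z"
  shows "(\<Sum>\<alpha>\<in>UNIV. W_expr d conn tors \<alpha> \<mu> \<alpha> \<sigma> z - W_expr d conn tors \<alpha> \<mu> \<sigma> \<alpha> z) =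
    cov01 d conn b \<sigma> \<mu> z + (\<Sum>\<alpha>\<in>UNIV. \<Sum>\<epsilon>\<in>UNIV. tors \<epsilon> \<alpha> \<sigma> z * tors \<alpha> \<mu> \<epsilon> z)
    + (\<Sum>\<alpha>\<in>UNIV. K \<alpha> \<alpha> \<mu> \<sigma> + K \<alpha> \<mu> \<sigma> \<alpha> + K \<alpha> \<sigma> \<alpha> \<mu>)"
proof -
  have "tors \<epsilon> \<sigma> \<alpha> z * tors \<alpha> \<mu> \<epsilon> z = - (tors \<epsilon> \<alpha> \<sigma> z * tors \<alpha> \<mu> \<epsilon> z)" for \<alpha> \<epsilon>
    by (simp add: tors_def algebra_simps)
  then show ?thesis
    using Bianchi_contracted[of \<mu> \<sigma>]
    unfolding W_expr_contract[OF point tors_smooth] b_def by (simp add: sum_negf)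
qed

end

section \<open>Half the torsion, and contracted W-tensors of other d-connections\<close>

lemma cov12_cmult:
  assumes "z \<in> \<Omega>" "smooth_on (A \<alpha> \<mu> \<nu>) \<Omega>"
  shows "cov12 d G (\<lambda>\<alpha> \<mu> \<nu> z. c * A \<alpha> \<mu> \<nu> z) \<alpha> \<mu> \<nu> \<sigma> z = c * cov12 d G A \<alpha> \<mu> \<nu> \<sigma> z"
  using d_cmult[OF assms] by (simp add: cov12_def sum_distrib_left algebra_simps)

text \<open>Halving \<open>S\<close> halves the derivative terms but quarters the products. Relative
  to half the full expression this leaves minus a quarter of the products, whence the coefficient
  1/4 and the order \<open>\<sigma> \<mu>\<close> in the trace term.\<close>

lemma W_expr_half_tors_contract:
  assumes "z \<in> \<Omega>"
  defines "b \<equiv> \<lambda>\<mu> z. \<Sum>\<alpha>\<in>UNIV. tors \<alpha> \<mu> \<alpha> z" and "S \<equiv> \<lambda>\<alpha> \<mu> \<nu> z. 1/2 * tors \<alpha> \<mu> \<nu> z"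
  shows "(\<Sum>\<alpha>\<in>UNIV. W_expr d conn S \<alpha> \<mu> \<alpha> \<sigma> z - W_expr d conn S \<alpha> \<mu> \<sigma> \<alpha> z) =
    1/2 * (\<Sum>\<alpha>\<in>UNIV. W_expr d conn tors \<alpha> \<mu> \<alpha> \<sigma> z - W_expr d conn tors \<alpha> \<mu> \<sigma> \<alpha> z)
    + 1/4 * ((\<Sum>\<epsilon>\<in>UNIV. b \<epsilon> z * tors \<epsilon> \<sigma> \<mu> z) + (\<Sum>\<alpha>\<in>UNIV. \<Sum>\<epsilon>\<in>UNIV. tors \<epsilon> \<sigma> \<alpha> z * tors \<alpha> \<mu> \<epsilon> z))"
proof -
  have S: "smooth_on (S \<alpha> \<mu> \<nu>) \<Omega>" for \<alpha> \<mu> \<nu>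
    unfolding S_def by (intro smooth_intros tors_smooth)
  have neg: "(\<Sum>\<epsilon>\<in>UNIV. b \<epsilon> z * tors \<epsilon> \<sigma> \<mu> z) = - (\<Sum>\<epsilon>\<in>UNIV. b \<epsilon> z * tors \<epsilon> \<mu> \<sigma> z)"
    unfolding sum_negf[symmetric] by (intro sum.cong refl) (simp add: tors_def algebra_simps)
  have cov: "cov12 d conn S \<alpha> \<mu> \<nu> \<sigma> z = 1/2 * cov12 d conn tors \<alpha> \<mu> \<nu> \<sigma> z" for \<alpha> \<mu> \<nu> \<sigma>
    unfolding S_def by (rule cov12_cmult[OF assms(1) tors_smooth])
  have SS: "(\<Sum>\<alpha>\<in>UNIV. \<Sum>\<epsilon>\<in>UNIV. S \<epsilon> \<sigma> \<alpha> z * S \<alpha> \<mu> \<epsilon> z) =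
      1/4 * (\<Sum>\<alpha>\<in>UNIV. \<Sum>\<epsilon>\<in>UNIV. tors \<epsilon> \<sigma> \<alpha> z * tors \<alpha> \<mu> \<epsilon> z)"
    by (simp add: S_def sum_distrib_left)
  have bS: "(\<Sum>\<epsilon>\<in>UNIV. (\<Sum>\<alpha>\<in>UNIV. S \<alpha> \<epsilon> \<alpha> z) * S \<epsilon> \<mu> \<sigma> z) = 1/4 * (\<Sum>\<epsilon>\<in>UNIV. b \<epsilon> z * tors \<epsilon> \<mu> \<sigma> z)"
    unfolding sum_distrib_left
    by (intro sum.cong refl) (simp add: S_def b_def sum_divide_distrib[symmetric])
  have cS: "cov01 d conn (\<lambda>\<mu> z. \<Sum>\<alpha>\<in>UNIV. S \<alpha> \<mu> \<alpha> z) \<mu> \<sigma> z = 1/2 * cov01 d conn b \<mu> \<sigma> z"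
    using cov01_contract[OF assms(1), where A = S, OF S]
      cov01_contract[OF assms(1), where A = tors, OF tors_smooth]
    unfolding b_def by (simp add: cov sum_divide_distrib)
  show ?thesis
    unfolding W_expr_contract[OF assms(1) S] W_expr_contract[OF assms(1) tors_smooth] neg SS bS cS
      cov sum_distrib_left[symmetric]
    by (simp add: b_def algebra_simps)
qed

text \<open>Uniqueness of the W-tensor identifies it with the antisymmetrised \<open>W_expr\<close>.
  The difference \<open>S\<close> will be the torsion for the dual connection, half of it for the
  symmetric one and the contortion for the Riemannian one.\<close>

lemma contr_hW_tensor:
  assumes "z \<in> \<Omega>" "\<And>\<alpha> \<mu> \<nu>. smooth_on (S \<alpha> \<mu> \<nu>) \<Omega>"
    and "d = delta (nlc D)" "\<And>\<alpha> \<mu> \<nu> z. hcoef D \<alpha> \<mu> \<nu> z = conn \<alpha> \<mu> \<nu> z - S \<alpha> \<mu> \<nu> z"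
  shows "contr (hW_tensor D lam) \<mu> \<sigma> z =
    (\<Sum>\<alpha>\<in>UNIV. W_expr d conn S \<alpha> \<mu> \<alpha> \<sigma> z - W_expr d conn S \<alpha> \<mu> \<sigma> \<alpha> z)"
  unfolding contr_def
proof (intro sum.cong refl, rule hW_tensor_eqI[OF lam_indep[OF assms(1)],
    where H = "\<lambda>\<alpha> \<mu> \<nu> \<sigma>. W_expr d conn S \<alpha> \<mu> \<nu> \<sigma> z - W_expr d conn S \<alpha> \<mu> \<sigma> \<nu> z"])
  show "hcov02 D (hcov01 D (coframe lam i)) \<mu> \<nu> \<sigma> z - hcov02 D (hcov01 D (coframe lam i)) \<mu> \<sigma> \<nu> z =
    (\<Sum>\<epsilon>\<in>UNIV. coframe lam i \<epsilon> z * (W_expr d conn S \<epsilon> \<mu> \<nu> \<sigma> z - W_expr d conn S \<epsilon> \<mu> \<sigma> \<nu> z))" for i \<mu> \<nu> \<sigma>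
    unfolding hcov02_def hcov01_def assms(3)[symmetric] cov02_cov01_coframe[OF assms(1,2,4)]
    by (simp add: right_diff_distrib sum_subtractf)
qed

lemma contr_vW_tensor:
  assumes "z \<in> \<Omega>" "\<And>\<alpha> \<mu> \<nu>. smooth_on (S \<alpha> \<mu> \<nu>) \<Omega>"
    and "d = pdy" "\<And>\<alpha> \<mu> \<nu> z. vcoef D \<alpha> \<mu> \<nu> z = conn \<alpha> \<mu> \<nu> z - S \<alpha> \<mu> \<nu> z"
  shows "contr (vW_tensor D lam) \<mu> \<sigma> z =
    (\<Sum>\<alpha>\<in>UNIV. W_expr d conn S \<alpha> \<mu> \<alpha> \<sigma> z - W_expr d conn S \<alpha> \<mu> \<sigma> \<alpha> z)"
  unfolding contr_def
proof (intro sum.cong refl, rule vW_tensor_eqI[OF lam_indep[OF assms(1)],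
    where V = "\<lambda>\<alpha> \<mu> \<nu> \<sigma>. W_expr d conn S \<alpha> \<mu> \<nu> \<sigma> z - W_expr d conn S \<alpha> \<mu> \<sigma> \<nu> z"])
  show "vcov02 D (vcov01 D (coframe lam i)) \<mu> \<nu> \<sigma> z - vcov02 D (vcov01 D (coframe lam i)) \<mu> \<sigma> \<nu> z =
    (\<Sum>\<epsilon>\<in>UNIV. coframe lam i \<epsilon> z * (W_expr d conn S \<epsilon> \<mu> \<nu> \<sigma> z - W_expr d conn S \<epsilon> \<mu> \<sigma> \<nu> z))" for i \<mu> \<nu> \<sigma>
    unfolding vcov02_def vcov01_def assms(3)[symmetric] cov02_cov01_coframe[OF assms(1,2,4)]
    by (simp add: right_diff_distrib sum_subtractf)
qed

section \<open>The metric of the frame and the trace of its Riemannian connection\<close>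

lemma lam_metric:
  assumes "z \<in> \<Omega>"
  shows "(\<Sum>\<gamma>\<in>UNIV. lam i \<gamma> z * metric lam \<beta> \<gamma> z) = coframe lam i \<beta> z"
proof -
  have "(\<Sum>\<gamma>\<in>UNIV. lam i \<gamma> z * metric lam \<beta> \<gamma> z) =
      (\<Sum>\<gamma>\<in>UNIV. \<Sum>j\<in>UNIV. coframe lam j \<beta> z * (lam i \<gamma> z * coframe lam j \<gamma> z))"
    by (simp add: metric_def sum_distrib_left mult_ac)
  also have "\<dots> = (\<Sum>j\<in>UNIV. \<Sum>\<gamma>\<in>UNIV. coframe lam j \<beta> z * (lam i \<gamma> z * coframe lam j \<gamma> z))"
    by (rule sum.swap)
  also have "\<dots> = coframe lam i \<beta> z"
    by (simp add: sum_distrib_left[symmetric] lam_dual(1)[OF assms] if_distrib cong: if_cong)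
  finally show ?thesis .
qed

text \<open>The frame is orthonormal, so \<open>?h\<close> is a left inverse of \<open>?g\<close>.
  For square matrices it is then two-sided, which makes the choice in \<open>matrix_inv\<close> a
  genuine inverse; multiplying by \<open>?h\<close> identifies the two.\<close>

lemma inv_metric_eq:
  assumes "z \<in> \<Omega>"
  shows "inv_metric lam \<alpha> \<beta> z = (\<Sum>i\<in>UNIV. lam i \<alpha> z * lam i \<beta> z)"
proof -
  let ?g = "\<chi> \<alpha> \<beta>. metric lam \<alpha> \<beta> z" and ?h = "\<chi> \<alpha> \<beta>. \<Sum>i\<in>UNIV. lam i \<alpha> z * lam i \<beta> z"
  have "(?h ** ?g) $ \<alpha> $ \<beta> = (if \<alpha> = \<beta> then 1 else 0)" for \<alpha> \<beta>
  proof -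
    have "(?h ** ?g) $ \<alpha> $ \<beta> =
        (\<Sum>\<gamma>\<in>UNIV. (\<Sum>i\<in>UNIV. lam i \<alpha> z * lam i \<gamma> z) * (\<Sum>j\<in>UNIV. coframe lam j \<beta> z * coframe lam j \<gamma> z))"
      by (simp add: matrix_matrix_mult_def metric_def mult.commute)
    also have "\<dots> = (\<Sum>\<gamma>\<in>UNIV. \<Sum>i\<in>UNIV. lam i \<alpha> z * (lam i \<gamma> z * (\<Sum>j\<in>UNIV. coframe lam j \<beta> z * coframe lam j \<gamma> z)))"
      by (simp add: sum_distrib_right mult.assoc)
    also have "\<dots> = (\<Sum>i\<in>UNIV. \<Sum>\<gamma>\<in>UNIV. lam i \<alpha> z * (lam i \<gamma> z * (\<Sum>j\<in>UNIV. coframe lam j \<beta> z * coframe lam j \<gamma> z)))"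
      by (rule sum.swap)
    also have "\<dots> = (\<Sum>i\<in>UNIV. lam i \<alpha> z * coframe lam i \<beta> z)"
      unfolding sum_distrib_left[symmetric] lam_metric[OF assms, unfolded metric_def] ..
    finally show ?thesis
      by (simp add: lam_dual(2)[OF assms])
  qed
  then have left: "?h ** ?g = mat 1"
    by (simp add: vec_eq_iff mat_def)
  then have "?g ** ?h = mat 1"
    by (simp add: matrix_left_right_inverse)
  with left have "\<exists>A. ?g ** A = mat 1 \<and> A ** ?g = mat 1"
    by blast
  then have "?g ** matrix_inv ?g = mat 1 \<and> matrix_inv ?g ** ?g = mat 1"
    unfolding matrix_inv_def by (rule someI_ex)
  then have "?h ** (?g ** matrix_inv ?g) = ?h"
    by simp
  then have "matrix_inv ?g = ?h"
    unfolding matrix_mul_assoc left matrix_mul_lid .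
  then show ?thesis
    by (simp add: inv_metric_def)
qed

definition levi_civita :: "'n \<Rightarrow> 'n \<Rightarrow> 'n \<Rightarrow> 'n tmfun" where
  "levi_civita \<alpha> \<mu> \<nu> z = 1/2 * (\<Sum>\<epsilon>\<in>UNIV. inv_metric lam \<alpha> \<epsilon> z *
     (d \<mu> (metric lam \<nu> \<epsilon>) z + d \<nu> (metric lam \<mu> \<epsilon>) z - d \<epsilon> (metric lam \<mu> \<nu>) z))"

lemma metric_smooth: "smooth_on (metric lam \<mu> \<nu>) \<Omega>"
  unfolding metric_def by (intro smooth_intros coframe_smooth)

lemma levi_civita_smooth: "smooth_on (levi_civita \<alpha> \<mu> \<nu>) \<Omega>"
proof -
  have "smooth_on (inv_metric lam \<alpha> \<epsilon>) \<Omega>" for \<alpha> \<epsilon>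
    by (rule smooth_on_cong[OF open_domain inv_metric_eq[symmetric]])
      (auto intro!: smooth_intros lam_smooth)
  then show ?thesis
    unfolding levi_civita_def by (intro smooth_intros metric_smooth)
qed

text \<open>This gives the equality of the traces of contortion and torsion. Symmetry of the inverse
  metric cancels two of the three metric derivatives, and the third differentiates a sum of products
  of coframe components, whose two halves contribute the same trace of \<open>conn\<close>.\<close>

lemma levi_civita_trace:
  assumes "z \<in> \<Omega>"
  shows "(\<Sum>\<epsilon>\<in>UNIV. levi_civita \<epsilon> \<mu> \<epsilon> z) = (\<Sum>\<epsilon>\<in>UNIV. conn \<epsilon> \<epsilon> \<mu> z)"
proof -
  let ?g = "\<lambda>\<alpha> \<beta>. inv_metric lam \<alpha> \<beta> z" and ?e = "\<lambda>i \<alpha>. coframe lam i \<alpha> z"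
    and ?de = "\<lambda>i \<alpha>. d \<mu> (coframe lam i \<alpha>) z"
  have g_sym: "?g \<alpha> \<beta> = ?g \<beta> \<alpha>" for \<alpha> \<beta>
    by (simp add: inv_metric_eq[OF assms] mult.commute)
  have metric_sym: "metric lam \<alpha> \<beta> = metric lam \<beta> \<alpha>" for \<alpha> \<beta>
    by (simp add: fun_eq_iff metric_def mult.commute)
  have raise: "(\<Sum>\<epsilon>\<in>UNIV. ?g \<alpha> \<epsilon> * ?e i \<epsilon>) = lam i \<alpha> z" for \<alpha> i
  proof -
    have "(\<Sum>\<epsilon>\<in>UNIV. ?g \<alpha> \<epsilon> * ?e i \<epsilon>) = (\<Sum>\<epsilon>\<in>UNIV. ?e i \<epsilon> * (\<Sum>j\<in>UNIV. lam j \<epsilon> z * lam j \<alpha> z))"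
      by (simp add: inv_metric_eq[OF assms] mult.commute)
    then show ?thesis
      by (simp add: coframe_expand[OF assms])
  qed
  have d_metric: "d \<mu> (metric lam \<alpha> \<beta>) z = (\<Sum>i\<in>UNIV. ?de i \<alpha> * ?e i \<beta> + ?de i \<beta> * ?e i \<alpha>)" for \<alpha> \<beta>
    unfolding metric_def
    by (simp add: d_sum[OF assms] d_mult[OF assms] smooth_intros coframe_smooth add.commute mult.commute)
  \<comment> \<open>Contracting the undifferentiated coframe factor with the inverse metric raises
    its index and yields the frame, hence a diagonal coefficient of \<open>conn\<close>.\<close>
  have half: "(\<Sum>\<alpha>\<in>UNIV. \<Sum>\<epsilon>\<in>UNIV. ?g \<alpha> \<epsilon> * (\<Sum>i\<in>UNIV. ?de i \<alpha> * ?e i \<epsilon>)) = (\<Sum>\<epsilon>\<in>UNIV. conn \<epsilon> \<epsilon> \<mu> z)"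
  proof (rule sum.cong[OF refl])
    fix \<alpha>
    have "(\<Sum>\<epsilon>\<in>UNIV. ?g \<alpha> \<epsilon> * (\<Sum>i\<in>UNIV. ?de i \<alpha> * ?e i \<epsilon>)) =
        (\<Sum>\<epsilon>\<in>UNIV. \<Sum>i\<in>UNIV. ?de i \<alpha> * (?g \<alpha> \<epsilon> * ?e i \<epsilon>))"
      by (simp add: sum_distrib_left mult_ac)
    also have "\<dots> = (\<Sum>i\<in>UNIV. \<Sum>\<epsilon>\<in>UNIV. ?de i \<alpha> * (?g \<alpha> \<epsilon> * ?e i \<epsilon>))"
      by (rule sum.swap)
    also have "\<dots> = conn \<alpha> \<alpha> \<mu> z"
      unfolding sum_distrib_left[symmetric] raise conn_def by (simp add: mult.commute)
    finally show "(\<Sum>\<epsilon>\<in>UNIV. ?g \<alpha> \<epsilon> * (\<Sum>i\<in>UNIV. ?de i \<alpha> * ?e i \<epsilon>)) = conn \<alpha> \<alpha> \<mu> z" .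
  qed
  have half': "(\<Sum>\<alpha>\<in>UNIV. \<Sum>\<epsilon>\<in>UNIV. ?g \<alpha> \<epsilon> * (\<Sum>i\<in>UNIV. ?de i \<epsilon> * ?e i \<alpha>)) = (\<Sum>\<epsilon>\<in>UNIV. conn \<epsilon> \<epsilon> \<mu> z)"
    unfolding half[symmetric] by (subst sum.swap) (simp add: g_sym)
  have cancel: "(\<Sum>\<alpha>\<in>UNIV. \<Sum>\<epsilon>\<in>UNIV. ?g \<alpha> \<epsilon> * d \<alpha> (metric lam \<mu> \<epsilon>) z) =
      (\<Sum>\<alpha>\<in>UNIV. \<Sum>\<epsilon>\<in>UNIV. ?g \<alpha> \<epsilon> * d \<epsilon> (metric lam \<mu> \<alpha>) z)"
    by (subst sum.swap) (simp add: g_sym)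
  have "(\<Sum>\<alpha>\<in>UNIV. levi_civita \<alpha> \<mu> \<alpha> z) =
      1/2 * (\<Sum>\<alpha>\<in>UNIV. \<Sum>\<epsilon>\<in>UNIV. ?g \<alpha> \<epsilon> * d \<mu> (metric lam \<alpha> \<epsilon>) z)"
    unfolding levi_civita_def sum_distrib_left[symmetric] distrib_left right_diff_distrib sum.distrib sum_subtractf cancel
    by simp
  also have "\<dots> = (\<Sum>\<epsilon>\<in>UNIV. conn \<epsilon> \<epsilon> \<mu> z)"
    unfolding d_metric sum.distrib distrib_left half half' by simp
  finally show ?thesis .
qed

end

section \<open>Partial and horizontal derivatives\<close>

lemma derivation_family_frechet_derivative:
  fixes \<Omega> :: "((real^'n::finite) \<times> (real^'n)) set" and v :: "'n \<Rightarrow> (real^'n) \<times> (real^'n)"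
  assumes "open \<Omega>"
  shows "derivation_family \<Omega> (\<lambda>\<mu> f z. frechet_derivative f (at z) (v \<mu>))"
proof
  fix f g :: "'n tmfun" and \<mu> z assume "z \<in> \<Omega>" "\<And>y. y \<in> \<Omega> \<Longrightarrow> f y = g y"
  then show "frechet_derivative f (at z) (v \<mu>) = frechet_derivative g (at z) (v \<mu>)"
    using frechet_derivative_cong_open[OF assms] by metis
qed (simp_all add: assms smooth_on_frechet_derivative frechet_derivative_add_at frechet_derivative_mult_at
    smooth_on_differentiable)

lemma derivation_family_pdx: "open \<Omega> \<Longrightarrow> derivation_family \<Omega> pdx"
  using derivation_family_frechet_derivative[of \<Omega> "\<lambda>\<mu>. (axis \<mu> 1, 0)"]
  by (simp add: pdx_def[abs_def])

lemma derivation_family_pdy: "open \<Omega> \<Longrightarrow> derivation_family \<Omega> pdy"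
  using derivation_family_frechet_derivative[of \<Omega> "\<lambda>\<mu>. (0, axis \<mu> 1)"]
  by (simp add: pdy_def[abs_def])

lemma pd_commute:
  assumes "open \<Omega>" "z \<in> \<Omega>" "smooth_on f \<Omega>"
  shows "pdx \<mu> (pdx \<nu> f) z = pdx \<nu> (pdx \<mu> f) z"
    and "pdx \<mu> (pdy \<nu> f) z = pdy \<nu> (pdx \<mu> f) z"
    and "pdy \<mu> (pdy \<nu> f) z = pdy \<nu> (pdy \<mu> f) z"
proof -
  have "C_k_on 2 f \<Omega>"
    using assms(3) by (simp add: smooth_on_def)
  from frechet_derivative_commute[OF assms(1,2) this]
  show "pdx \<mu> (pdx \<nu> f) z = pdx \<nu> (pdx \<mu> f) z"
    "pdx \<mu> (pdy \<nu> f) z = pdy \<nu> (pdx \<mu> f) z"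
    "pdy \<mu> (pdy \<nu> f) z = pdy \<nu> (pdy \<mu> f) z"
    unfolding pdx_def[abs_def] pdy_def[abs_def] by blast+
qed

context
  fixes \<Omega> :: "((real^'n::finite) \<times> (real^'n)) set" and N :: "'n \<Rightarrow> 'n \<Rightarrow> 'n tmfun"
  assumes open_\<Omega>: "open \<Omega>" and N_smooth: "\<And>\<alpha> \<mu>. smooth_on (N \<alpha> \<mu>) \<Omega>"
begin

interpretation X: derivation_family \<Omega> pdx
  by (rule derivation_family_pdx[OF open_\<Omega>])

interpretation Y: derivation_family \<Omega> pdy
  by (rule derivation_family_pdy[OF open_\<Omega>])

lemma derivation_family_delta: "derivation_family \<Omega> (delta N)"
proof
  show "open \<Omega>" by (rule open_\<Omega>)
next
  fix f :: "'n tmfun" and \<mu>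
  assume "smooth_on f \<Omega>"
  then show "smooth_on (delta N \<mu> f) \<Omega>"
    unfolding delta_def[abs_def] by (intro X.smooth_intros Y.smooth_intros N_smooth)
next
  fix f g :: "'n tmfun" and \<mu> z
  assume "z \<in> \<Omega>" "\<And>y. y \<in> \<Omega> \<Longrightarrow> f y = g y"
  then show "delta N \<mu> f z = delta N \<mu> g z"
    using X.d_cong[of z f g] Y.d_cong[of z f g] by (simp add: delta_def)
qed (simp_all add: delta_def X.d_const Y.d_const X.d_add Y.d_add X.d_mult Y.d_mult sum.distrib
    sum_distrib_left sum_distrib_right algebra_simps)

interpretation H: derivation_family \<Omega> "delta N"
  by (rule derivation_family_delta)

text \<open>In the expansion below, exchanging \<open>\<sigma>\<close> and \<open>\<nu>\<close>
  fixes the pure \<open>x\<close>-derivative, swaps the two mixed sums and fixes the double vertical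
  sum, all because partial derivatives commute. Only derivatives of \<open>N\<close> survive the
  difference, and they form \<open>N_curv\<close>.\<close>

lemma delta_commutator:
  assumes "z \<in> \<Omega>" "smooth_on f \<Omega>"
  shows "delta N \<sigma> (delta N \<nu> f) z - delta N \<nu> (delta N \<sigma> f) z = (\<Sum>\<epsilon>\<in>UNIV. N_curv N \<epsilon> \<sigma> \<nu> z * pdy \<epsilon> f z)"
proof -
  have expand: "delta N \<sigma> (delta N \<nu> f) z =
      pdx \<sigma> (pdx \<nu> f) z - (\<Sum>\<alpha>\<in>UNIV. N \<alpha> \<sigma> z * pdx \<nu> (pdy \<alpha> f) z) - (\<Sum>\<alpha>\<in>UNIV. N \<alpha> \<nu> z * pdx \<sigma> (pdy \<alpha> f) z)
      + (\<Sum>\<alpha>\<in>UNIV. \<Sum>\<beta>\<in>UNIV. N \<alpha> \<nu> z * (N \<beta> \<sigma> z * pdy \<beta> (pdy \<alpha> f) z))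
      - (\<Sum>\<alpha>\<in>UNIV. delta N \<sigma> (N \<alpha> \<nu>) z * pdy \<alpha> f z)" for \<sigma> \<nu>
  proof -
    have delta_f: "delta N \<nu> f = (\<lambda>z. pdx \<nu> f z - (\<Sum>\<alpha>\<in>UNIV. N \<alpha> \<nu> z * pdy \<alpha> f z))"
      by (simp add: fun_eq_iff delta_def)
    have "delta N \<sigma> (delta N \<nu> f) z =
        delta N \<sigma> (pdx \<nu> f) z - (\<Sum>\<alpha>\<in>UNIV. N \<alpha> \<nu> z * delta N \<sigma> (pdy \<alpha> f) z + delta N \<sigma> (N \<alpha> \<nu>) z * pdy \<alpha> f z)"
      unfolding delta_f
      by (simp add: H.d_diff H.d_sum H.d_mult assms N_smooth X.smooth_intros Y.d_smooth)
    also have "delta N \<sigma> (pdx \<nu> f) z = pdx \<sigma> (pdx \<nu> f) z - (\<Sum>\<alpha>\<in>UNIV. N \<alpha> \<sigma> z * pdx \<nu> (pdy \<alpha> f) z)"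
      by (simp add: delta_def pd_commute(2)[OF open_\<Omega> assms])
    also have "(\<Sum>\<alpha>\<in>UNIV. N \<alpha> \<nu> z * delta N \<sigma> (pdy \<alpha> f) z + delta N \<sigma> (N \<alpha> \<nu>) z * pdy \<alpha> f z) =
        (\<Sum>\<alpha>\<in>UNIV. N \<alpha> \<nu> z * pdx \<sigma> (pdy \<alpha> f) z)
        - (\<Sum>\<alpha>\<in>UNIV. \<Sum>\<beta>\<in>UNIV. N \<alpha> \<nu> z * (N \<beta> \<sigma> z * pdy \<beta> (pdy \<alpha> f) z))
        + (\<Sum>\<alpha>\<in>UNIV. delta N \<sigma> (N \<alpha> \<nu>) z * pdy \<alpha> f z)"
    proof -
      have "delta N \<sigma> (pdy \<alpha> f) z = pdx \<sigma> (pdy \<alpha> f) z - (\<Sum>\<beta>\<in>UNIV. N \<beta> \<sigma> z * pdy \<beta> (pdy \<alpha> f) z)" for \<alpha>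
        by (simp add: delta_def)
      then show ?thesis
        by (simp only: sum.distrib right_diff_distrib sum_subtractf sum_distrib_left)
    qed
    finally show ?thesis by simp
  qed
  have sym: "(\<Sum>\<alpha>\<in>UNIV. \<Sum>\<beta>\<in>UNIV. N \<alpha> \<nu> z * (N \<beta> \<sigma> z * pdy \<beta> (pdy \<alpha> f) z)) =
      (\<Sum>\<alpha>\<in>UNIV. \<Sum>\<beta>\<in>UNIV. N \<alpha> \<sigma> z * (N \<beta> \<nu> z * pdy \<beta> (pdy \<alpha> f) z))"
    by (subst sum.swap) (simp add: pd_commute(3)[OF open_\<Omega> assms] mult.left_commute)
  show ?thesis
    unfolding expand[of \<sigma> \<nu>] expand[of \<nu> \<sigma>] sym
    by (simp add: pd_commute(1)[OF open_\<Omega> assms, of \<sigma> \<nu>] N_curv_def left_diff_distrib sum_subtractf)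
qed

end

section \<open>The four identities in an induced chart\<close>

lemma open_induced_range:
  assumes "gap_space \<A> lam" "c \<in> \<A>"
  shows "open (induced_range c)"
proof -
  have "open (snd c ` fst c)"
    using assms unfolding gap_space_def smooth_atlas_def by (cases c) fastforce
  then show ?thesis
    by (simp add: induced_range_def open_Times)
qed

theorem proposition7p4:
  fixes \<A> :: "('m::{t2_space, second_countable_topology}, 'n::finite) chart set"
    and lam N :: "('m, 'n) chart \<Rightarrow> 'n \<Rightarrow> 'n \<Rightarrow> 'n tmfun"
    and c :: "('m, 'n) chart"
    and z :: "(real^'n) \<times> (real^'n)"
    and \<mu> \<sigma> :: 'n
  assumes gap: "gap_space \<A> lam"
    and nlconn: "nonlinear_connection \<A> N"
    and chart: "c \<in> \<A>"
    and point: "z \<in> induced_range c"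
  defines "D \<equiv> canonical_dconn (N c) (lam c)"
  defines "\<Lambda> \<equiv> h_torsion D"
    and "T \<equiv> v_torsion D"
    and "\<gamma> \<equiv> h_contortion (N c) (lam c)"
    and "\<beta> \<equiv> h_basic D"
    and "B \<equiv> v_basic D"
    and "L \<equiv> L_tensor D"
    and "H_dual \<equiv> contr (hW_tensor (dual_dconn D) (lam c))"
    and "V_dual \<equiv> contr (vW_tensor (dual_dconn D) (lam c))"
    and "H_sym \<equiv> contr (hW_tensor (symmetric_dconn D) (lam c))"
    and "H_riem \<equiv> contr (hW_tensor (riemannian_dconn (N c) (lam c)) (lam c))"
  shows "(H_dual \<mu> \<sigma> z =
      hcov01 D \<beta> \<sigma> \<mu> z
      + (\<Sum>\<alpha>\<in>UNIV. \<Sum>\<epsilon>\<in>UNIV. \<Lambda> \<epsilon> \<alpha> \<sigma> z * \<Lambda> \<alpha> \<mu> \<epsilon> z)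
      + (\<Sum>\<alpha>\<in>UNIV. L \<alpha> \<alpha> \<mu> \<sigma> z + L \<alpha> \<mu> \<sigma> \<alpha> z + L \<alpha> \<sigma> \<alpha> \<mu> z)) \<and>
    (V_dual \<mu> \<sigma> z =
      vcov01 D B \<sigma> \<mu> z
      + (\<Sum>\<alpha>\<in>UNIV. \<Sum>\<epsilon>\<in>UNIV. T \<epsilon> \<alpha> \<sigma> z * T \<alpha> \<mu> \<epsilon> z)) \<and>
    (H_sym \<mu> \<sigma> z =
      1/2 * H_dual \<mu> \<sigma> z
      + 1/4 * ((\<Sum>\<epsilon>\<in>UNIV. \<beta> \<epsilon> z * \<Lambda> \<epsilon> \<sigma> \<mu> z)
        + (\<Sum>\<alpha>\<in>UNIV. \<Sum>\<epsilon>\<in>UNIV. \<Lambda> \<epsilon> \<sigma> \<alpha> z * \<Lambda> \<alpha> \<mu> \<epsilon> z))) \<and>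
    (H_riem \<mu> \<sigma> z =
      hcov01 D \<beta> \<mu> \<sigma> z
      - (\<Sum>\<alpha>\<in>UNIV. hcov12 D \<gamma> \<alpha> \<mu> \<sigma> \<alpha> z)
      + (\<Sum>\<epsilon>\<in>UNIV. \<beta> \<epsilon> z * \<gamma> \<epsilon> \<mu> \<sigma> z)
      - (\<Sum>\<alpha>\<in>UNIV. \<Sum>\<epsilon>\<in>UNIV. \<gamma> \<epsilon> \<sigma> \<alpha> z * \<gamma> \<alpha> \<mu> \<epsilon> z))"
proof -
  let ?\<Omega> = "induced_range c" and ?lam = "lam c"
  have open_\<Omega>: "open ?\<Omega>"
    by (rule open_induced_range[OF gap chart])
  have N_smooth: "smooth_on (N c \<alpha> \<beta>) ?\<Omega>" for \<alpha> \<beta>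
    using nlconn chart unfolding nonlinear_connection_def by blast
  have frame: "frame_derivation_axioms ?\<Omega> ?lam"
  proof
    show "smooth_on (?lam i \<alpha>) ?\<Omega>" for i \<alpha>
      using gap chart unfolding gap_space_def by blast
  qed (rule gap_space_indep[OF gap chart])
  \<comment> \<open>One frame with two families of derivations: \<open>H.conn\<close> is
    \<open>\<Gamma>\<close> and \<open>V.conn\<close> is \<open>C\<close>.\<close>
  interpret H: frame_derivation ?\<Omega> "delta (N c)" ?lam
    by (rule frame_derivation.intro[OF derivation_family_delta[OF open_\<Omega> N_smooth] frame])
  interpret V: frame_derivation ?\<Omega> pdy ?lam
    by (rule frame_derivation.intro[OF derivation_family_pdy[OF open_\<Omega>] frame])
  have D: "hcoef D = H.conn" "vcoef D = V.conn" "nlc D = N c"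
    by (simp_all add: fun_eq_iff D_def canonical_dconn_def H.conn_def V.conn_def)
  have \<Lambda>: "\<Lambda> = H.tors" and T: "T = V.tors"
    by (simp_all add: fun_eq_iff \<Lambda>_def T_def h_torsion_def v_torsion_def D H.tors_def V.tors_def)
  have \<beta>: "\<beta> = (\<lambda>\<mu> z. \<Sum>\<alpha>\<in>UNIV. H.tors \<alpha> \<mu> \<alpha> z)" and B: "B = (\<lambda>\<mu> z. \<Sum>\<alpha>\<in>UNIV. V.tors \<alpha> \<mu> \<alpha> z)"
    unfolding \<Lambda>[symmetric] T[symmetric]
    by (simp_all add: fun_eq_iff \<beta>_def B_def h_basic_def v_basic_def \<Lambda>_def T_def)
  have cov: "hcov01 D = cov01 (delta (N c)) H.conn" "vcov01 D = cov01 pdy V.conn"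
    "hcov12 D = cov12 (delta (N c)) H.conn"
    by (simp_all add: fun_eq_iff hcov01_def vcov01_def hcov12_def D)

  \<comment> \<open>The tensor \<open>L\<close> enters here: the horizontal commutator is
    \<open>N_curv\<close> times vertical derivatives, and the vertical derivative of the coframe is
    the coframe times \<open>C\<close>.\<close>
  have h_commutator: "delta (N c) \<sigma> (delta (N c) \<nu> (coframe ?lam i \<mu>)) z - delta (N c) \<nu> (delta (N c) \<sigma> (coframe ?lam i \<mu>)) z =
      (\<Sum>\<alpha>\<in>UNIV. coframe ?lam i \<alpha> z * L \<alpha> \<mu> \<sigma> \<nu> z)" for i \<mu> \<nu> \<sigma>
  proof -
    have "(\<Sum>\<epsilon>\<in>UNIV. N_curv (N c) \<epsilon> \<sigma> \<nu> z * pdy \<epsilon> (coframe ?lam i \<mu>) z) =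
        (\<Sum>\<epsilon>\<in>UNIV. \<Sum>\<alpha>\<in>UNIV. coframe ?lam i \<alpha> z * (V.conn \<alpha> \<mu> \<epsilon> z * N_curv (N c) \<epsilon> \<sigma> \<nu> z))"
      by (simp add: V.d_coframe[OF point] sum_distrib_left mult_ac)
    also have "\<dots> = (\<Sum>\<alpha>\<in>UNIV. coframe ?lam i \<alpha> z * L \<alpha> \<mu> \<sigma> \<nu> z)"
      by (subst sum.swap) (simp add: L_def L_tensor_def D sum_distrib_left)
    finally show ?thesis
      by (simp add: delta_commutator[OF open_\<Omega> N_smooth point H.coframe_smooth])
  qed
  \<comment> \<open>The zero is written as a four-index function so that it can take the place of
    \<open>K\<close>.\<close>
  have v_commutator: "pdy \<sigma> (pdy \<nu> (coframe ?lam i \<mu>)) z - pdy \<nu> (pdy \<sigma> (coframe ?lam i \<mu>)) z =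
      (\<Sum>\<alpha>\<in>UNIV. coframe ?lam i \<alpha> z * (\<lambda>\<alpha> \<mu> \<sigma> \<nu>. 0) \<alpha> \<mu> \<sigma> \<nu>)" for i \<mu> \<nu> \<sigma>
    using pd_commute(3)[OF open_\<Omega> point H.coframe_smooth] by simp

  have H_dual: "H_dual \<mu> \<sigma> z = (\<Sum>\<alpha>\<in>UNIV. W_expr (delta (N c)) H.conn H.tors \<alpha> \<mu> \<alpha> \<sigma> z
      - W_expr (delta (N c)) H.conn H.tors \<alpha> \<mu> \<sigma> \<alpha> z)"
    unfolding H_dual_def
    by (rule H.contr_hW_tensor[OF point H.tors_smooth]) (simp_all add: dual_dconn_def D H.tors_def)
  have V_dual: "V_dual \<mu> \<sigma> z = (\<Sum>\<alpha>\<in>UNIV. W_expr pdy V.conn V.tors \<alpha> \<mu> \<alpha> \<sigma> z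
      - W_expr pdy V.conn V.tors \<alpha> \<mu> \<sigma> \<alpha> z)"
    unfolding V_dual_def
    by (rule V.contr_vW_tensor[OF point V.tors_smooth]) (simp_all add: dual_dconn_def D V.tors_def)
  have H_sym: "H_sym \<mu> \<sigma> z =
      (\<Sum>\<alpha>\<in>UNIV. W_expr (delta (N c)) H.conn (\<lambda>\<alpha> \<mu> \<nu> z. 1/2 * H.tors \<alpha> \<mu> \<nu> z) \<alpha> \<mu> \<alpha> \<sigma> z
      - W_expr (delta (N c)) H.conn (\<lambda>\<alpha> \<mu> \<nu> z. 1/2 * H.tors \<alpha> \<mu> \<nu> z) \<alpha> \<mu> \<sigma> \<alpha> z)"
    unfolding H_sym_def
  proof (rule H.contr_hW_tensor[OF point])
    show "smooth_on (\<lambda>z. 1/2 * H.tors \<alpha> \<mu> \<nu> z) ?\<Omega>" for \<alpha> \<mu> \<nu>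
      by (intro H.smooth_intros H.tors_smooth)
  qed (simp_all add: symmetric_dconn_def D H.tors_def field_simps)

  let ?R = "riemannian_dconn (N c) ?lam"
  have R: "hcoef ?R = H.levi_civita" "nlc ?R = N c"
    by (simp_all add: fun_eq_iff riemannian_dconn_def H.levi_civita_def)
  have \<gamma>: "\<gamma> \<alpha> \<mu> \<nu> = (\<lambda>z. H.conn \<alpha> \<mu> \<nu> z - H.levi_civita \<alpha> \<mu> \<nu> z)" for \<alpha> \<mu> \<nu>
    unfolding \<gamma>_def h_contortion_def[abs_def] D_def[symmetric] by (simp add: D R)
  have \<gamma>_smooth: "smooth_on (\<gamma> \<alpha> \<mu> \<nu>) ?\<Omega>" for \<alpha> \<mu> \<nu>
    unfolding \<gamma> by (intro H.smooth_intros H.conn_smooth H.levi_civita_smooth)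
  \<comment> \<open>Stated on the whole range, because the trace is differentiated below.\<close>
  have \<gamma>_trace: "(\<Sum>\<alpha>\<in>UNIV. \<gamma> \<alpha> \<mu> \<alpha> y) = \<beta> \<mu> y" if "y \<in> ?\<Omega>" for y \<mu>
    using H.levi_civita_trace[OF that] by (simp add: \<gamma> \<beta> H.tors_def sum_subtractf)
  have "H_riem \<mu> \<sigma> z = (\<Sum>\<alpha>\<in>UNIV. W_expr (delta (N c)) H.conn \<gamma> \<alpha> \<mu> \<alpha> \<sigma> z
      - W_expr (delta (N c)) H.conn \<gamma> \<alpha> \<mu> \<sigma> \<alpha> z)"
    unfolding H_riem_def
    by (rule H.contr_hW_tensor[OF point \<gamma>_smooth]) (simp_all add: R \<gamma>)
  \<comment> \<open>\<open>W_expr_contract\<close> produces the trace of \<open>\<gamma>\<close>; it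
    is exchanged for \<open>\<beta>\<close> under the derivation by \<open>d_cong\<close> and
    pointwise in the connection term.\<close>
  moreover have "cov01 (delta (N c)) H.conn (\<lambda>\<mu> z. \<Sum>\<alpha>\<in>UNIV. \<gamma> \<alpha> \<mu> \<alpha> z) \<mu> \<sigma> z = cov01 (delta (N c)) H.conn \<beta> \<mu> \<sigma> z"
  proof -
    have "delta (N c) \<sigma> (\<lambda>z. \<Sum>\<alpha>\<in>UNIV. \<gamma> \<alpha> \<mu> \<alpha> z) z = delta (N c) \<sigma> (\<beta> \<mu>) z"
      by (rule H.d_cong[OF point]) (rule \<gamma>_trace)
    then show ?thesis
      unfolding cov01_def by (simp only: \<gamma>_trace[OF point])
  qed
  ultimately have "H_riem \<mu> \<sigma> z =
      hcov01 D \<beta> \<mu> \<sigma> z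
      - (\<Sum>\<alpha>\<in>UNIV. hcov12 D \<gamma> \<alpha> \<mu> \<sigma> \<alpha> z)
      + (\<Sum>\<epsilon>\<in>UNIV. \<beta> \<epsilon> z * \<gamma> \<epsilon> \<mu> \<sigma> z)
      - (\<Sum>\<alpha>\<in>UNIV. \<Sum>\<epsilon>\<in>UNIV. \<gamma> \<epsilon> \<sigma> \<alpha> z * \<gamma> \<alpha> \<mu> \<epsilon> z)"
    by (simp add: H.W_expr_contract[OF point \<gamma>_smooth] \<gamma>_trace[OF point] cov)
  moreover have "H_sym \<mu> \<sigma> z =
      1/2 * H_dual \<mu> \<sigma> z
      + 1/4 * ((\<Sum>\<epsilon>\<in>UNIV. \<beta> \<epsilon> z * \<Lambda> \<epsilon> \<sigma> \<mu> z)
        + (\<Sum>\<alpha>\<in>UNIV. \<Sum>\<epsilon>\<in>UNIV. \<Lambda> \<epsilon> \<sigma> \<alpha> z * \<Lambda> \<alpha> \<mu> \<epsilon> z))"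
    unfolding H_sym H_dual \<beta> \<Lambda> by (rule H.W_expr_half_tors_contract[OF point])
  moreover have "V_dual \<mu> \<sigma> z =
      vcov01 D B \<sigma> \<mu> z
      + (\<Sum>\<alpha>\<in>UNIV. \<Sum>\<epsilon>\<in>UNIV. T \<epsilon> \<alpha> \<sigma> z * T \<alpha> \<mu> \<epsilon> z)"
    using V.W_expr_tors_contract[OF point v_commutator] unfolding V_dual cov B T by simp
  moreover have "H_dual \<mu> \<sigma> z =
      hcov01 D \<beta> \<sigma> \<mu> z
      + (\<Sum>\<alpha>\<in>UNIV. \<Sum>\<epsilon>\<in>UNIV. \<Lambda> \<epsilon> \<alpha> \<sigma> z * \<Lambda> \<alpha> \<mu> \<epsilon> z)
      + (\<Sum>\<alpha>\<in>UNIV. L \<alpha> \<alpha> \<mu> \<sigma> z + L \<alpha> \<mu> \<sigma> \<alpha> z + L \<alpha> \<sigma> \<alpha> \<mu> z)"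
    unfolding H_dual cov \<beta> \<Lambda> by (rule H.W_expr_tors_contract[OF point h_commutator])
  ultimately show ?thesis
    by (intro conjI)
qed

end
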